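(* Let $\boldsymbol{\sigma}=(\sigma_n)_{n\ge0}$ be a sequence of morphisms $\sigma_n:\mathcal{A}_{n+1}\to\mathcal{A}_n^+$ such that $\liminf_{n\to\infty}|\mathcal{A}_n|<\infty$ and $\sup_{n\ge0}|\{\mathcal{L}_x:\ x\in X_{\boldsymbol{\sigma}}^{(n)}\}|<\infty$. Then $\boldsymbol{\sigma}$ is eventually recognizable for aperiodic points, i.e., there is $n_0\in\mathbb{N}$ such that for every $n\ge n_0$, every aperiodic $y\in\mathcal{A}_n^{\mathbb{Z}}$ has at most one centered $\sigma_n$-representation in $X_{\boldsymbol{\sigma}}^{(n+1)}$.
   Context: Alphabets are finite. A morphism $\sigma:\mathcal{A}\to\mathcal{B}^+$ is given by a non-empty word $\sigma(a)$ for each letter $a$ and is extended by concatenation to $\mathcal{A}^*$ and $\mathcal{A}^{\mathbb{Z}}$ (with $\sigma(x_0)$ starting at index $0$ in $\sigma(x)$). $T$ is the left shift. A point $y$ is periodic if $T^k(y)=y$ for some $k\ge1$, aperiodic otherwise. For a two-sided sequence $x$, $\mathcal{L}_x$ is its language, the set of all its finite subwords (factors). A $\sigma$-representation of $y\in\mathcal{B}^{\mathbb{Z}}$ is a pair $(k,x)$ with $k\in\mathbb{Z}$, $x\in\mathcal{A}^{\mathbb{Z}}$, $y=T^k\sigma(x)$; it is centered if $0\le k<|\sigma(x_0)|$, and it is in $X\subseteq\mathcal{A}^{\mathbb{Z}}$ if $x\in X$. For $0\le n<N$, $\sigma_{[n,N)}=\sigma_n\circ\cdots\circ\sigma_{N-1}$.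 The language $\mathcal{L}_{\boldsymbol{\sigma}}^{(n)}$ is the set of all $w\in\mathcal{A}_n^*$ that are subwords of $\sigma_{[n,N)}(a)$ for some $N>n$ and $a\in\mathcal{A}_N$; $X_{\boldsymbol{\sigma}}^{(n)}$ is the set of $x\in\mathcal{A}_n^{\mathbb{Z}}$ all of whose finite subwords belong to $\mathcal{L}_{\boldsymbol{\sigma}}^{(n)}$. *)

theory Defs
  imports Complex_Main "HOL-Library.Sublist" "HOL-Library.Extended_Nat"
    "HOL-Library.Liminf_Limsup"
begin

text \<open>Letters live in an ambient type; alphabets are (finite) sets of letters. Two-sided sequences
  over the alphabet \<open>A\<close> are functions \<open>int \<Rightarrow> 'a\<close> with all values in \<open>A\<close>.\<close>

definition full_shift :: "'a set \<Rightarrow> (int \<Rightarrow> 'a) set" where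
  "full_shift A = {x. \<forall>i. x i \<in> A}"

definition is_morphism :: "'a set \<Rightarrow> 'b set \<Rightarrow> ('a \<Rightarrow> 'b list) \<Rightarrow> bool" where
  "is_morphism A B \<sigma> \<longleftrightarrow> (\<forall>a\<in>A. \<sigma> a \<noteq> [] \<and> set (\<sigma> a) \<subseteq> B)"

definition word_ext :: "('a \<Rightarrow> 'b list) \<Rightarrow> 'a list \<Rightarrow> 'b list" where
  "word_ext \<sigma> w = concat (map \<sigma> w)"

text \<open>\<open>cut \<sigma> x i\<close> is the index in \<open>\<sigma>(x)\<close> at which the block \<open>\<sigma>(x\<^sub>i)\<close> starts, so \<open>cut \<sigma> x 0 = 0\<close>. For
  every \<open>i\<close> at least one of the two sums is empty.\<close>

definition cut :: "('a \<Rightarrow> 'b list) \<Rightarrow> (int \<Rightarrow> 'a) \<Rightarrow> int \<Rightarrow> int" where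
  "cut \<sigma> x i = (\<Sum>j\<in>{0..<i}. int (length (\<sigma> (x j)))) - (\<Sum>j\<in>{i..<0}. int (length (\<sigma> (x j))))"

definition seq_ext :: "('a \<Rightarrow> 'b list) \<Rightarrow> (int \<Rightarrow> 'a) \<Rightarrow> int \<Rightarrow> 'b" where
  "seq_ext \<sigma> x m =
     (let i = (THE i. cut \<sigma> x i \<le> m \<and> m < cut \<sigma> x (i + 1)) in \<sigma> (x i) ! nat (m - cut \<sigma> x i))"

lemma cut_0: "cut \<sigma> x 0 = 0"
  by (simp add: cut_def)

lemma cut_step: "cut \<sigma> x (i + 1) = cut \<sigma> x i + int (length (\<sigma> (x i)))"
proof (cases "0 \<le> i")
  case True
  then have "{0..<i + 1} = insert i {0..<i}" by auto
  with True show ?thesis by (simp add: cut_def)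
next
  case False
  then have "{i..<0} = insert i {i + 1..<0}" by auto
  with False show ?thesis by (simp add: cut_def)
qed

lemma cut_mono:
  assumes "i \<le> j"
  shows "cut \<sigma> x i \<le> cut \<sigma> x j"
  using assms by (induction j rule: int_ge_induct) (auto simp: cut_step)

text \<open>The description of \<open>\<sigma>(x)\<close> as the concatenation of the blocks \<open>\<sigma>(x\<^sub>i)\<close>, the block \<open>\<sigma>(x\<^sub>0)\<close>
  starting at index 0.\<close>

lemma seq_ext_block:
  assumes "j < length (\<sigma> (x i))"
  shows "seq_ext \<sigma> x (cut \<sigma> x i + int j) = \<sigma> (x i) ! j"
proof -
  let ?m = "cut \<sigma> x i + int j"
  have "(THE k. cut \<sigma> x k \<le> ?m \<and> ?m < cut \<sigma> x (k + 1)) = i"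
  proof (rule the_equality)
    show "cut \<sigma> x i \<le> ?m \<and> ?m < cut \<sigma> x (i + 1)"
      using assms by (simp add: cut_step)
    fix k assume k: "cut \<sigma> x k \<le> ?m \<and> ?m < cut \<sigma> x (k + 1)"
    show "k = i"
    proof (rule ccontr)
      assume "k \<noteq> i"
      then consider "k + 1 \<le> i" | "i + 1 \<le> k" by linarith
      then show False
      proof cases
        case 1
        from cut_mono[OF this, of \<sigma> x] k show False by simp
      next
        case 2
        from cut_mono[OF this, of \<sigma> x] k assms show False by (simp add: cut_step)
      qed
    qed
  qed
  then show ?thesis by (simp add: seq_ext_def)
qed

text \<open>The power \<open>T\<^sup>k\<close>, \<open>k \<in> \<int>\<close>, of the left shift.\<close>

definition shift :: "int \<Rightarrow> (int \<Rightarrow> 'a) \<Rightarrow> int \<Rightarrow> 'a" where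
  "shift k y = (\<lambda>i. y (i + k))"

definition periodic :: "(int \<Rightarrow> 'a) \<Rightarrow> bool" where
  "periodic y \<longleftrightarrow> (\<exists>k\<ge>1. shift k y = y)"

abbreviation aperiodic :: "(int \<Rightarrow> 'a) \<Rightarrow> bool" where
  "aperiodic y \<equiv> \<not> periodic y"

definition lang :: "(int \<Rightarrow> 'a) \<Rightarrow> 'a list set" where
  "lang x = {map (\<lambda>j. x (i + int j)) [0..<l] | i l. True}"

definition representation ::
  "('a \<Rightarrow> 'b list) \<Rightarrow> (int \<Rightarrow> 'a) set \<Rightarrow> (int \<Rightarrow> 'b) \<Rightarrow> int \<times> (int \<Rightarrow> 'a) \<Rightarrow> bool" where
  "representation \<sigma> X y = (\<lambda>(k, x). x \<in> X \<and> y = shift k (seq_ext \<sigma> x))"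

definition centered_representation ::
  "('a \<Rightarrow> 'b list) \<Rightarrow> (int \<Rightarrow> 'a) set \<Rightarrow> (int \<Rightarrow> 'b) \<Rightarrow> int \<times> (int \<Rightarrow> 'a) \<Rightarrow> bool" where
  "centered_representation \<sigma> X y =
     (\<lambda>(k, x). representation \<sigma> X y (k, x) \<and> 0 \<le> k \<and> k < int (length (\<sigma> (x 0))))"

text \<open>\<open>comp_range \<sigma> n N\<close> is \<open>\<sigma>\<^sub>n \<circ> \<dots> \<circ> \<sigma>\<^sub>N\<^sub>-\<^sub>1\<close>, as a map on words.\<close>

definition comp_range :: "(nat \<Rightarrow> 'a \<Rightarrow> 'a list) \<Rightarrow> nat \<Rightarrow> nat \<Rightarrow> 'a list \<Rightarrow> 'a list" where
  "comp_range \<sigma> n N = foldr (\<lambda>m f. word_ext (\<sigma> m) \<circ> f) [n..<N] id"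

definition level_lang :: "(nat \<Rightarrow> 'a set) \<Rightarrow> (nat \<Rightarrow> 'a \<Rightarrow> 'a list) \<Rightarrow> nat \<Rightarrow> 'a list set" where
  "level_lang A \<sigma> n = {w \<in> lists (A n). \<exists>N>n. \<exists>a\<in>A N. sublist w (comp_range \<sigma> n N [a])}"

definition level_shift :: "(nat \<Rightarrow> 'a set) \<Rightarrow> (nat \<Rightarrow> 'a \<Rightarrow> 'a list) \<Rightarrow> nat \<Rightarrow> (int \<Rightarrow> 'a) set" where
  "level_shift A \<sigma> n = {x \<in> full_shift (A n). lang x \<subseteq> level_lang A \<sigma> n}"

text \<open>Cardinality with value \<open>\<infinity>\<close> on infinite sets, where \<open>card\<close> would give 0.\<close>

definition ecard :: "'a set \<Rightarrow> enat" where
  "ecard S = (if finite S then enat (card S) else \<infinity>)"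

end

theory Submission
  imports Defs "HOL-Library.Diagonal_Subsequence"
begin

text \<open>Let \<open>rank n\<close> be the least number of words over \<open>A n\<close> whose concatenations include all the words
  \<open>\<sigma>\<^sub>n \<circ> \<dots> \<circ> \<sigma>\<^sub>N\<^sub>-\<^sub>1 (a)\<close>, \<open>a \<in> A N\<close>, for some \<open>N > n\<close>. It is nondecreasing in \<open>n\<close> and bounded by
  \<open>liminf |A n|\<close>, hence eventually constant. If \<open>rank n = rank (n + 1)\<close>, realised at level \<open>n + 1\<close> by a
  set \<open>F\<close> of words, then the restriction of \<open>\<sigma>\<^sub>n\<close> to \<open>F\<close> is elementary: its images are not
  concatenations of fewer than \<open>|F|\<close> words. By compactness every point of the shift at level \<open>n + 1\<close>
  is a concatenation of words of \<open>F\<close>, so it suffices that an aperiodic point has at most one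
  factorization over an elementary morphism (the defect theorem for bi-infinite words of Karhumaki,
  Manuch and Plandowski).

  Given two factorizations, refine both by a common set of cuts which looks the same in all blocks
  carrying the same letter, and choose such a set with as few cuts as possible inside the blocks.
  Then each piece between consecutive cuts is the first piece of some block, for otherwise all the
  cuts in front of that piece could be erased. As the morphism is elementary, the pieces are
  as numerous as the letters, so that the first piece of a block determines its letter. Therefore the
  overlap between the two factorizations at a cut determines the overlap at the next one; there are
  finitely many overlaps, so either the point is periodic or all overlaps are empty.\<close>

section \<open>Tilings of two-sided sequences\<close>

text \<open>A pair \<open>(t, c) \<in> U\<close> stands for a block \<open>\<sigma> c\<close> placed at position \<open>t\<close>.\<close>

definition tiling :: "('c \<Rightarrow> 'b list) \<Rightarrow> 'c set \<Rightarrow> (int \<Rightarrow> 'b) \<Rightarrow> (int \<times> 'c) set \<Rightarrow> bool" where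
  "tiling \<sigma> C y U \<longleftrightarrow>
     (\<forall>(t, c)\<in>U. c \<in> C \<and> \<sigma> c \<noteq> [] \<and> (\<forall>j<length (\<sigma> c). y (t + int j) = \<sigma> c ! j)) \<and>
     (\<forall>s. \<exists>!u. u \<in> U \<and> fst u \<le> s \<and> s < fst u + int (length (\<sigma> (snd u))))"

lemma tilingD:
  assumes "tiling \<sigma> C y U" "(t, c) \<in> U"
  shows "c \<in> C" "\<sigma> c \<noteq> []" "j < length (\<sigma> c) \<Longrightarrow> y (t + int j) = \<sigma> c ! j"
  using assms unfolding tiling_def by auto

lemma tiling_cover:
  assumes "tiling \<sigma> C y U"
  obtains t c where "(t, c) \<in> U" "t \<le> s" "s < t + int (length (\<sigma> c))"
proof -
  have "\<exists>u. u \<in> U \<and> fst u \<le> s \<and> s < fst u + int (length (\<sigma> (snd u)))"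
    using assms unfolding tiling_def by blast
  then show ?thesis using that by (metis prod.collapse)
qed

lemma tiling_unique:
  assumes "tiling \<sigma> C y U" "(t, c) \<in> U" "(t', c') \<in> U"
    and "t \<le> s" "s < t + int (length (\<sigma> c))" "t' \<le> s" "s < t' + int (length (\<sigma> c'))"
  shows "t = t'" "c = c'"
proof -
  have "\<exists>!u. u \<in> U \<and> fst u \<le> s \<and> s < fst u + int (length (\<sigma> (snd u)))"
    using assms unfolding tiling_def by blast
  then have "(t, c) = (t', c')" using assms by (metis fst_conv snd_conv)
  then show "t = t'" "c = c'" by auto
qed

text \<open>The block covering the position behind \<open>\<sigma> c\<close> must start there:
  starting earlier, it would share the position \<open>max t t'\<close> with
  \<open>(t, c)\<close>.\<close>

lemma tiling_next:
  assumes T: "tiling \<sigma> C y U" and u: "(t, c) \<in> U"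
  shows "\<exists>c'. (t + int (length (\<sigma> c)), c') \<in> U"
proof -
  let ?e = "t + int (length (\<sigma> c))"
  obtain t' c' where t': "(t', c') \<in> U" "t' \<le> ?e" "?e < t' + int (length (\<sigma> c'))"
    using tiling_cover[OF T] by blast
  have "t' = ?e"
  proof (rule ccontr)
    assume "t' \<noteq> ?e"
    with t' have "t' < ?e" by simp
    then have "t = t' \<and> c = c'"
      using tiling_unique[OF T u t'(1), of "max t t'"] t' tilingD(2)[OF T u] tilingD(2)[OF T t'(1)]
      by auto
    with t' show False by simp
  qed
  with t' show ?thesis by auto
qed

lemma tiling_prev:
  assumes T: "tiling \<sigma> C y U" and u: "(t, c) \<in> U"
  shows "\<exists>t' c'. (t', c') \<in> U \<and> t' + int (length (\<sigma> c')) = t"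
proof -
  obtain t' c' where t': "(t', c') \<in> U" "t' \<le> t - 1" "t - 1 < t' + int (length (\<sigma> c'))"
    using tiling_cover[OF T] by blast
  have "t' + int (length (\<sigma> c')) = t"
  proof (rule ccontr)
    assume "t' + int (length (\<sigma> c')) \<noteq> t"
    then have "t' = t"
      using tiling_unique[OF T t'(1) u, of t] t' tilingD(2)[OF T u] by auto
    with t' show False by simp
  qed
  with t' show ?thesis by auto
qed

lemma bi_infinite_path:
  assumes "a \<in> S" and succ: "\<And>u. u \<in> S \<Longrightarrow> \<exists>v\<in>S. R u v" and pred: "\<And>u. u \<in> S \<Longrightarrow> \<exists>v\<in>S. R v u"
  shows "\<exists>f :: int \<Rightarrow> 'a. (\<forall>i. f i \<in> S) \<and> (\<forall>i. R (f i) (f (i + 1)))"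
proof -
  obtain g where g: "g 0 = a" "\<And>n. g n \<in> S" "\<And>n. R (g n) (g (Suc n))"
    using dependent_nat_choice[of "\<lambda>n u. u \<in> S \<and> (n = 0 \<longrightarrow> u = a)" "\<lambda>_. R"] assms(1) succ by auto
  obtain h where h: "h 0 = a" "\<And>n. h n \<in> S" "\<And>n. R (h (Suc n)) (h n)"
    using dependent_nat_choice[of "\<lambda>n u. u \<in> S \<and> (n = 0 \<longrightarrow> u = a)" "\<lambda>_ u v. R v u"] assms(1) pred
    by auto
  define f where "f i = (if i \<ge> 0 then g (nat i) else h (nat (- i)))" for i :: int
  have "R (f i) (f (i + 1))" for i
  proof (cases "i \<ge> 0")
    case True
    then show ?thesis using g(3)[of "nat i"] by (simp add: f_def nat_add_distrib)
  next
    case False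
    then have "nat (- i) = Suc (nat (- (i + 1)))" by simp
    with False show ?thesis using h(3)[of "nat (- (i + 1))"] g(1) h(1)
      by (cases "i = -1") (auto simp: f_def)
  qed
  moreover have "f i \<in> S" for i using g h by (simp add: f_def)
  ultimately show ?thesis by blast
qed

lemma strict_increasing_cover:
  fixes p :: "int \<Rightarrow> int"
  assumes inc: "\<And>i. p i < p (i + 1)"
  obtains i where "p i \<le> s" "s < p (i + 1)"
proof -
  have "\<exists>i. p i \<le> s \<and> s < p (i + 1)"
  proof (induction s rule: int_induct[where k = "p 0"])
    case base
    then show ?case using inc[of 0] by auto
  next
    case (step1 s)
    then obtain i where i: "p i \<le> s" "s < p (i + 1)" by blast
    show ?case
      using i inc[of "i + 1"] by (cases "s + 1 < p (i + 1)") (auto intro: exI[of _ i] exI[of _ "i + 1"])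
  next
    case (step2 s)
    then obtain i where i: "p i \<le> s" "s < p (i + 1)" by blast
    show ?case
      using i inc[of "i - 1"] by (cases "p i \<le> s - 1") (auto intro: exI[of _ i] exI[of _ "i - 1"])
  qed
  then show ?thesis using that by blast
qed

text \<open>Following successors and predecessors of one block gives a path that covers every
  position, so by uniqueness it misses no block of \<open>U\<close>.\<close>

lemma tiling_enumeration:
  fixes \<sigma> :: "'a \<Rightarrow> 'b list"
  assumes T: "tiling \<sigma> C y U"
  shows "\<exists>(p :: int \<Rightarrow> int) x. U = range (\<lambda>i. (p i, x i)) \<and>
    (\<forall>i. p (i + 1) = p i + int (length (\<sigma> (x i))))"
proof -
  obtain t0 c0 where u0: "(t0, c0) \<in> U" using tiling_cover[OF T] by blast
  have succ: "\<exists>v\<in>U. fst v = fst u + int (length (\<sigma> (snd u)))" if "u \<in> U" for u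
    using tiling_next[OF T, of "fst u" "snd u"] that by force
  have pred: "\<exists>v\<in>U. fst u = fst v + int (length (\<sigma> (snd v)))" if "u \<in> U" for u
    using tiling_prev[OF T, of "fst u" "snd u"] that by force
  have "\<exists>f :: int \<Rightarrow> int \<times> 'a. (\<forall>i. f i \<in> U) \<and>
      (\<forall>i. fst (f (i + 1)) = fst (f i) + int (length (\<sigma> (snd (f i)))))"
    by (rule bi_infinite_path[OF u0 succ pred])
  then obtain f :: "int \<Rightarrow> int \<times> 'a" where f: "\<And>i. f i \<in> U"
    "\<And>i. fst (f (i + 1)) = fst (f i) + int (length (\<sigma> (snd (f i))))" by auto
  have "u \<in> range f" if "u \<in> U" for u
  proof -
    have "fst (f i) < fst (f (i + 1))" for i
      using f(2)[of i] tilingD(2)[OF T, of "fst (f i)" "snd (f i)"] f(1) by simp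
    then obtain i where i: "fst (f i) \<le> fst u" "fst u < fst (f (i + 1))"
      using strict_increasing_cover[of "\<lambda>i. fst (f i)" "fst u"] by blast
    have "u = f i"
      using tiling_unique[OF T, of "fst u" "snd u" "fst (f i)" "snd (f i)" "fst u"] that f i
        tilingD(2)[OF T, of "fst u" "snd u"] by (simp add: prod_eq_iff)
    then show ?thesis by simp
  qed
  then have "U = range (\<lambda>i. (fst (f i), snd (f i)))" using f by auto
  then show ?thesis using f(2)
    by (intro exI[of _ "\<lambda>i. fst (f i)"] exI[of _ "\<lambda>i. snd (f i)"]) simp
qed

text \<open>Determinism makes every repetition persist to the right. In a two-sided sequence a
  repetition can be found to the left of any index, so there is no preperiod.\<close>

lemma deterministic_imp_periodic:
  fixes s :: "int \<Rightarrow> 'v"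
  assumes fin: "finite (range s)" and det: "\<And>i k. s i = s k \<Longrightarrow> s (i + 1) = s (k + 1)"
  shows "\<exists>m>0. \<forall>i. s (i + int m) = s i"
proof -
  define v where "v = card (range s)"
  have adv: "s (i + int e) = s (k + int e)" if "s i = s k" for i k e
  proof (induction e)
    case (Suc e)
    then show ?case using det[OF Suc] by (simp add: ac_simps)
  qed (use that in simp)
  have "s (i + int (fact v)) = s i" for i
  proof -
    have "\<not> inj_on (\<lambda>j. s (i - int v + int j)) {0..v}"
    proof
      assume "inj_on (\<lambda>j. s (i - int v + int j)) {0..v}"
      then have "card {0..v} \<le> card (range s)"
        by (rule card_inj_on_le) (use fin in auto)
      then show False by (simp add: v_def)
    qed
    then obtain a b where "a \<in> {0..v}" "b \<in> {0..v}" "a \<noteq> b"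
      "s (i - int v + int a) = s (i - int v + int b)" unfolding inj_on_def by blast
    then obtain a b where ab: "a < b" "b \<le> v" "s (i - int v + int a) = s (i - int v + int b)"
      by (metis atLeastAtMost_iff nat_neq_iff)
    define d where "d = b - a"
    have step: "s (i + int e) = s (i + int e + int d)" for e
      using adv[OF ab(3), of "v - a + e"] ab by (simp add: d_def of_nat_diff algebra_simps)
    have mult: "s (i + int (k * d)) = s i" for k
    proof (induction k)
      case (Suc k)
      then show ?case using step[of "k * d"] by (simp add: algebra_simps)
    qed simp
    \<comment> \<open>The local period \<open>d\<close> depends on \<open>i\<close> but never
      exceeds \<open>v\<close>, so \<open>fact v\<close> serves all indices.\<close>
    have "d dvd fact v" using ab by (intro dvd_fact) (auto simp: d_def)
    then obtain k where "fact v = k * d" by (metis dvd_def mult.commute)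
    then show ?thesis using mult[of k] by simp
  qed
  then show ?thesis by (intro exI[of _ "fact v"]) simp
qed

section \<open>Cutting a sequence into pieces\<close>

definition piece :: "(int \<Rightarrow> 'b) \<Rightarrow> int set \<Rightarrow> int \<Rightarrow> 'b list \<Rightarrow> bool" where
  "piece y Q s w \<longleftrightarrow> w \<noteq> [] \<and> s \<in> Q \<and> s + int (length w) \<in> Q \<and>
     (\<forall>j. 0 < j \<and> j < length w \<longrightarrow> s + int j \<notin> Q) \<and> (\<forall>j<length w. y (s + int j) = w ! j)"

text \<open>Cuts are compared along with letters, so that pieces can be moved from \<open>s\<close>
  to \<open>s'\<close>. The window is half-open; its right end has to be assumed a cut where that
  matters.\<close>

definition agree :: "(int \<Rightarrow> 'b) \<Rightarrow> int set \<Rightarrow> int \<Rightarrow> int \<Rightarrow> nat \<Rightarrow> bool" where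
  "agree y Q s s' n \<longleftrightarrow>
     (\<forall>j<n. y (s + int j) = y (s' + int j) \<and> (s + int j \<in> Q \<longleftrightarrow> s' + int j \<in> Q))"

lemma piece_unique:
  assumes "piece y Q s w" "piece y Q s w'"
  shows "w = w'"
proof -
  have "length w = length w'"
    using assms unfolding piece_def by (metis length_greater_0_conv linorder_neqE_nat)
  then show ?thesis using assms unfolding piece_def by (intro nth_equalityI) auto
qed

lemma piece_exists:
  assumes "s \<in> Q" "s + int n \<in> Q" "n > 0"
  obtains w where "piece y Q s w" "length w \<le> n"
proof -
  define l where "l = (LEAST l. 0 < l \<and> s + int l \<in> Q)"
  have l: "0 < l \<and> s + int l \<in> Q" unfolding l_def by (rule LeastI[of _ n]) (use assms in simp)
  have le: "l \<le> n" unfolding l_def by (rule Least_le) (use assms in simp)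
  have "s + int j \<notin> Q" if "0 < j" "j < l" for j
    using that not_less_Least[of j "\<lambda>l. 0 < l \<and> s + int l \<in> Q"] unfolding l_def by blast
  then have "piece y Q s (map (\<lambda>j. y (s + int j)) [0..<l])"
    using l assms by (auto simp: piece_def)
  then show ?thesis using that le by auto
qed

text \<open>The cut at \<open>s + int n\<close> stops the piece inside the window. A piece of length
  exactly \<open>n\<close> ends where agreement says nothing, hence the assumption on
  \<open>s' + int n\<close>.\<close>

lemma piece_transfer:
  assumes "piece y Q s w" "agree y Q s s' n" "n > 0" "s + int n \<in> Q" "s' + int n \<in> Q"
  shows "piece y Q s' w"
proof -
  have le: "length w \<le> n" using assms unfolding piece_def by (meson not_le)
  have eq: "y (s + int j) = y (s' + int j)" "s + int j \<in> Q \<longleftrightarrow> s' + int j \<in> Q" if "j < n" for j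
    using assms(2) that unfolding agree_def by auto
  have "s' + int (length w) \<in> Q"
  proof (cases "length w = n")
    case False
    then show ?thesis using eq(2)[of "length w"] le assms(1) by (simp add: piece_def)
  qed (use assms in simp)
  moreover have "s' \<in> Q" using eq(2)[of 0] assms by (simp add: piece_def)
  ultimately show ?thesis using assms(1) le eq unfolding piece_def by (metis order_less_le_trans)
qed

text \<open>Peel off the piece at \<open>a\<close> and recurse. Thus the pieces form a generating
  set to which \<open>elementary\<close> can be applied.\<close>

lemma word_in_pieces:
  assumes "a \<in> Q" "a + int n \<in> Q"
  shows "map (\<lambda>j. y (a + int j)) [0..<n] \<in> concat ` lists {w. \<exists>s. piece y Q s w}"
  using assms
proof (induction n arbitrary: a rule: less_induct)
  case (less n)
  show ?case
  proof (cases "n = 0")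
    case True
    then show ?thesis by (auto intro!: image_eqI[of _ _ "[]"])
  next
    case False
    then obtain w where w: "piece y Q a w" "length w \<le> n"
      using piece_exists[OF less.prems, of y] by auto
    let ?a = "a + int (length w)" and ?n = "n - length w"
    have "map (\<lambda>j. y (?a + int j)) [0..<?n] \<in> concat ` lists {w. \<exists>s. piece y Q s w}"
      using less.IH[of ?n ?a] w less.prems False by (auto simp: piece_def of_nat_diff)
    then obtain ws where ws: "ws \<in> lists {w. \<exists>s. piece y Q s w}"
      "map (\<lambda>j. y (?a + int j)) [0..<?n] = concat ws" by auto
    have "map (\<lambda>j. y (a + int j)) [0..<n] = w @ map (\<lambda>j. y (?a + int j)) [0..<?n]"
      using w by (intro nth_equalityI) (auto simp: piece_def nth_append of_nat_diff)
    also have "\<dots> = concat (w # ws)" using ws by simp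
    finally show ?thesis using ws(1) w(1) by (intro image_eqI[of _ _ "w # ws"]) auto
  qed
qed

section \<open>Uniqueness of tilings by elementary morphisms\<close>

text \<open>Elementary morphisms of Ehrenfeucht and Rozenberg: no factorization through a smaller
  alphabet. The intermediate alphabet appears only through the set \<open>F\<close> of its
  images.\<close>

definition elementary :: "('c \<Rightarrow> 'b list) \<Rightarrow> 'c set \<Rightarrow> bool" where
  "elementary \<sigma> C \<longleftrightarrow>
     (\<forall>F. finite F \<longrightarrow> (\<forall>c\<in>C. \<sigma> c \<in> concat ` lists F) \<longrightarrow> card C \<le> card F)"

locale two_tilings =
  fixes \<sigma> :: "'c \<Rightarrow> 'b list" and C :: "'c set" and y :: "int \<Rightarrow> 'b" and U V :: "(int \<times> 'c) set"
  assumes finite_C: "finite C" and U: "tiling \<sigma> C y U" and V: "tiling \<sigma> C y V"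
begin

text \<open>Ranging over \<open>U \<union> V\<close> forces a block of \<open>U\<close> and a block
  of \<open>V\<close> with the same letter to be cut alike, which makes the two tilings
  comparable.\<close>

definition compatible :: "int set \<Rightarrow> bool" where
  "compatible Q \<longleftrightarrow> fst ` (U \<union> V) \<subseteq> Q \<and>
     (\<forall>c t t' j. (t, c) \<in> U \<union> V \<longrightarrow> (t', c) \<in> U \<union> V \<longrightarrow> j < length (\<sigma> c) \<longrightarrow>
        (t + int j \<in> Q \<longleftrightarrow> t' + int j \<in> Q))"

text \<open>A compatible set is infinite; minimality is measured on this finite set of offsets
  instead.\<close>

definition relative_cuts :: "int set \<Rightarrow> ('c \<times> nat) set" where
  "relative_cuts Q = {(c, j). j < length (\<sigma> c) \<and> (\<exists>t. (t, c) \<in> U \<union> V \<and> t + int j \<in> Q)}"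

lemma finite_relative_cuts: "finite (relative_cuts Q)"
proof (rule finite_subset)
  show "relative_cuts Q \<subseteq> (SIGMA c:C. {..<length (\<sigma> c)})"
    unfolding relative_cuts_def using tilingD(1)[OF U] tilingD(1)[OF V] by auto
qed (use finite_C in auto)

lemma blockD:
  assumes "(t, c) \<in> U \<union> V"
  shows "c \<in> C" "\<sigma> c \<noteq> []" "j < length (\<sigma> c) \<Longrightarrow> y (t + int j) = \<sigma> c ! j"
  using assms tilingD[OF U] tilingD[OF V] by auto

section \<open>Compatible cut sets and first pieces of blocks\<close>

context
  fixes Q
  assumes Q: "compatible Q"
begin

lemma start_in:
  assumes "(t, c) \<in> U \<union> V"
  shows "t \<in> Q"
proof -
  have "t \<in> fst ` (U \<union> V)" using assms by (rule image_eqI[rotated]) simp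
  then show ?thesis using Q unfolding compatible_def by blast
qed

lemma end_in:
  assumes "(t, c) \<in> U \<union> V"
  shows "t + int (length (\<sigma> c)) \<in> Q"
proof -
  have "\<exists>c'. (t + int (length (\<sigma> c)), c') \<in> U \<union> V"
    using assms tiling_next[OF U] tiling_next[OF V] by blast
  then show ?thesis using start_in by blast
qed

lemma block_agree:
  assumes "(t, c) \<in> U \<union> V" "(t', c) \<in> U \<union> V"
  shows "agree y Q t t' (length (\<sigma> c))"
  unfolding agree_def
proof (intro allI impI conjI)
  fix j assume j: "j < length (\<sigma> c)"
  show "y (t + int j) = y (t' + int j)"
    using blockD(3)[OF assms(1) j] blockD(3)[OF assms(2) j] by simp
  show "t + int j \<in> Q \<longleftrightarrow> t' + int j \<in> Q" using Q assms j unfolding compatible_def by blast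
qed

lemma piece_at:
  assumes "s \<in> Q"
  obtains w where "piece y Q s w"
proof -
  obtain t c where t: "(t, c) \<in> U" "t \<le> s" "s < t + int (length (\<sigma> c))"
    using tiling_cover[OF U] by blast
  have e: "s + int (nat (t + int (length (\<sigma> c)) - s)) \<in> Q" using end_in[of t c] t by simp
  obtain w where "piece y Q s w" using piece_exists[OF assms e, of y] t by auto
  then show ?thesis by (rule that)
qed

text \<open>A piece starting inside a block stops no later than the end of the block, which is a
  cut; so it depends only on letter and offset.\<close>

lemma piece_in_block:
  assumes "(t, c) \<in> U \<union> V" "(t', c) \<in> U \<union> V" "j < length (\<sigma> c)" "piece y Q (t + int j) w"
  shows "piece y Q (t' + int j) w"
proof (rule piece_transfer[OF assms(4), where n = "length (\<sigma> c) - j"])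
  show "agree y Q (t + int j) (t' + int j) (length (\<sigma> c) - j)"
    unfolding agree_def
  proof (intro allI impI)
    fix i assume "i < length (\<sigma> c) - j"
    then have "j + i < length (\<sigma> c)" by simp
    then have "y (t + int (j + i)) = y (t' + int (j + i)) \<and>
        (t + int (j + i) \<in> Q \<longleftrightarrow> t' + int (j + i) \<in> Q)"
      using block_agree[OF assms(1,2)] unfolding agree_def by blast
    then show "y (t + int j + int i) = y (t' + int j + int i) \<and>
        (t + int j + int i \<in> Q \<longleftrightarrow> t' + int j + int i \<in> Q)"
      by (simp add: add.assoc)
  qed
qed (use assms end_in[OF assms(1)] end_in[OF assms(2)] in \<open>simp_all add: of_nat_diff\<close>)

text \<open>If no block began with \<open>d\<close>, the cuts in front of all occurrences of
  \<open>d\<close> could be erased: block starts survive, and whether \<open>d\<close> occurs at an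
  offset depends on the letter alone.\<close>

lemma first_piece_surj:
  assumes min: "\<And>Q'. compatible Q' \<Longrightarrow> card (relative_cuts Q) \<le> card (relative_cuts Q')"
    and p: "piece y Q s d"
  obtains t c where "(t, c) \<in> U \<union> V" "piece y Q t d"
proof (rule ccontr)
  assume "\<not> thesis"
  with that have no: "\<And>t c. (t, c) \<in> U \<union> V \<Longrightarrow> \<not> piece y Q t d" by blast
  \<comment> \<open>Glue every occurrence of \<open>d\<close> to the piece before it.\<close>
  define Q' where "Q' = {t \<in> Q. \<not> piece y Q t d}"
  have Q': "compatible Q'"
    unfolding compatible_def
  proof (intro conjI allI impI)
    show "fst ` (U \<union> V) \<subseteq> Q'" using no start_in unfolding Q'_def by force
    fix c t t' j assume *: "(t, c) \<in> U \<union> V" "(t', c) \<in> U \<union> V" "j < length (\<sigma> c)"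
    then have "t + int j \<in> Q \<longleftrightarrow> t' + int j \<in> Q" using Q unfolding compatible_def by blast
    then show "t + int j \<in> Q' \<longleftrightarrow> t' + int j \<in> Q'"
      unfolding Q'_def using piece_in_block[OF *] piece_in_block[OF *(2,1,3)] by blast
  qed
  obtain t c where t: "(t, c) \<in> U" "t \<le> s" "s < t + int (length (\<sigma> c))"
    using tiling_cover[OF U] by blast
  define j where "j = nat (s - t)"
  have s: "s = t + int j" and j: "j < length (\<sigma> c)" using t unfolding j_def by auto
  have "s \<notin> Q'" using p unfolding Q'_def by simp
  \<comment> \<open>One block of \<open>c\<close> cut at \<open>j\<close> would put the pair into
    \<open>relative_cuts Q'\<close>; compatibility of \<open>Q'\<close> excludes all such blocks at
    once.\<close>
  then have "(c, j) \<notin> relative_cuts Q'"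
    using Q' t(1) j s unfolding relative_cuts_def compatible_def by blast
  moreover have "(c, j) \<in> relative_cuts Q"
    using p t(1) j s unfolding relative_cuts_def piece_def by blast
  moreover have "relative_cuts Q' \<subseteq> relative_cuts Q"
    unfolding relative_cuts_def Q'_def by blast
  ultimately have "card (relative_cuts Q') < card (relative_cuts Q)"
    by (intro psubset_card_mono finite_relative_cuts) blast
  with min[OF Q'] show False by simp
qed

text \<open>Counting: taking first pieces maps the occurring letters onto the set \<open>D\<close>
  of all pieces. The images of these letters are concatenations over \<open>D\<close>, so
  elementarity makes \<open>D\<close> at least as large as the set of these letters, and the map is
  injective.\<close>

lemma first_piece_inj:
  assumes min: "\<And>Q'. compatible Q' \<Longrightarrow> card (relative_cuts Q) \<le> card (relative_cuts Q')"
    and el: "elementary \<sigma> C"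
    and b: "(t, c) \<in> U \<union> V" "(t', c') \<in> U \<union> V" "piece y Q t w" "piece y Q t' w"
  shows "c = c'"
proof -
  define C0 where "C0 = snd ` (U \<union> V)"
  define D where "D = {w. \<exists>s. piece y Q s w}"
  define \<phi> where "\<phi> c = (SOME w. \<exists>t. (t, c) \<in> U \<union> V \<and> piece y Q t w)" for c
  have \<phi>: "\<phi> c = w" if "(t, c) \<in> U \<union> V" "piece y Q t w" for t c w
    unfolding \<phi>_def
  proof (rule some_equality)
    show "\<exists>t. (t, c) \<in> U \<union> V \<and> piece y Q t w" using that by blast
    fix v assume "\<exists>t. (t, c) \<in> U \<union> V \<and> piece y Q t v"
    then obtain t' where "(t', c) \<in> U \<union> V" "piece y Q t' v" by blast
    then have "piece y Q t v"
      using piece_in_block[of t' c t 0 v] that blockD(2) by auto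
    then show "v = w" using that piece_unique by blast
  qed
  have C0: "C0 \<subseteq> C" unfolding C0_def using blockD(1) by force
  then have finC0: "finite C0" using finite_C finite_subset by blast
  have D: "D = \<phi> ` C0"
  proof
    show "D \<subseteq> \<phi> ` C0"
    proof
      fix d assume "d \<in> D"
      then obtain s where "piece y Q s d" unfolding D_def by blast
      then obtain t c where "(t, c) \<in> U \<union> V" "piece y Q t d"
        using first_piece_surj[OF min] by blast
      then show "d \<in> \<phi> ` C0" using \<phi> unfolding C0_def by force
    qed
    show "\<phi> ` C0 \<subseteq> D"
    proof
      fix d assume "d \<in> \<phi> ` C0"
      then obtain t c where t: "(t, c) \<in> U \<union> V" "d = \<phi> c"
        unfolding C0_def by (metis imageE prod.collapse)
      obtain w where w: "piece y Q t w" using piece_at[OF start_in[OF t(1)]] .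
      then show "d \<in> D" using \<phi>[OF t(1) w] t(2) unfolding D_def by auto
    qed
  qed
  \<comment> \<open>Letters occurring in neither tiling yield no pieces. Their own images are added,
    which costs at most \<open>card (C - C0)\<close> words.\<close>
  define F where "F = D \<union> \<sigma> ` (C - C0)"
  have "\<sigma> c \<in> concat ` lists F" if "c \<in> C" for c
  proof (cases "c \<in> C0")
    case True
    then obtain t where t: "(t, c) \<in> U \<union> V" unfolding C0_def by (metis imageE prod.collapse)
    have "map (\<lambda>j. y (t + int j)) [0..<length (\<sigma> c)] = \<sigma> c"
      using blockD(3)[OF t] by (intro nth_equalityI) auto
    then have "\<sigma> c \<in> concat ` lists D"
      using word_in_pieces[OF start_in[OF t] end_in[OF t], of y] unfolding D_def by simp
    then show ?thesis unfolding F_def using lists_mono[of D "D \<union> \<sigma> ` (C - C0)"] by blast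
  next
    case False
    then show ?thesis using that unfolding F_def by (intro image_eqI[of _ _ "[\<sigma> c]"]) auto
  qed
  moreover have "finite F" unfolding F_def D using finC0 finite_C by simp
  ultimately have "card C \<le> card F" using el unfolding elementary_def by blast
  also have "\<dots> \<le> card D + card (\<sigma> ` (C - C0))" unfolding F_def by (rule card_Un_le)
  also have "\<dots> \<le> card D + card (C - C0)" using finite_C by (simp add: card_image_le)
  also have "card (C - C0) = card C - card C0" using C0 finC0 by (simp add: card_Diff_subset)
  finally have "card C0 \<le> card (\<phi> ` C0)" using card_mono[OF finite_C C0] by (simp add: D)
  then have "inj_on \<phi> C0" using finC0 by (simp add: card_image_le eq_card_imp_inj_on le_antisym)
  moreover have "c \<in> C0" "c' \<in> C0" using b unfolding C0_def by force+
  moreover have "\<phi> c = \<phi> c'" using \<phi> b by metis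
  ultimately show ?thesis by (simp add: inj_on_def)
qed

end

section \<open>Determinism of the overlaps between two tilings\<close>

context
  fixes Q
  assumes Q: "compatible Q"
    and inj: "\<And>t c t' c' w. (t, c) \<in> U \<union> V \<Longrightarrow> (t', c') \<in> U \<union> V \<Longrightarrow>
      piece y Q t w \<Longrightarrow> piece y Q t' w \<Longrightarrow> c = c'"
begin

text \<open>The window may be shorter than the blocks, but as it ends at cuts it contains a whole
  first piece, which determines the letter.\<close>

lemma same_letter:
  assumes "(t, c) \<in> U \<union> V" "(t', c') \<in> U \<union> V" "agree y Q t t' n"
    and "n > 0" "t + int n \<in> Q" "t' + int n \<in> Q"
  shows "c = c'"
proof -
  obtain w where w: "piece y Q t w" using piece_at[OF Q start_in[OF Q assms(1)]] .
  show ?thesis using inj[OF assms(1,2) w piece_transfer[OF w assms(3-6)]] .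
qed

text \<open>The state at a cut \<open>t\<close> of \<open>U\<close> records the overlap up to the next cut of \<open>V\<close>; it is empty iff
  \<open>t\<close> is a common cut.\<close>

definition ahead :: "int \<Rightarrow> nat" where
  "ahead t = (LEAST l. t + int l \<in> fst ` V)"

definition state :: "int \<Rightarrow> ('b \<times> bool) list" where
  "state t = map (\<lambda>j. (y (t + int j), t + int j \<in> Q)) [0..<ahead t]"

lemma ahead:
  shows "t + int (ahead t) \<in> fst ` V" and "j < ahead t \<Longrightarrow> t + int j \<notin> fst ` V"
    and "ahead t \<le> Max (length ` \<sigma> ` C)"
proof -
  obtain t' c where t': "(t', c) \<in> V" "t' \<le> t" "t < t' + int (length (\<sigma> c))"
    using tiling_cover[OF V] by blast
  define l where "l = nat (t' + int (length (\<sigma> c)) - t)"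
  have l: "t + int l \<in> fst ` V" "l \<le> length (\<sigma> c)"
    using tiling_next[OF V t'(1)] t' by (force simp: l_def)+
  show "t + int (ahead t) \<in> fst ` V" unfolding ahead_def using l(1) by (rule LeastI)
  show "j < ahead t \<Longrightarrow> t + int j \<notin> fst ` V" unfolding ahead_def by (rule not_less_Least)
  have "ahead t \<le> l" unfolding ahead_def using l(1) by (rule Least_le)
  also have "\<dots> \<le> Max (length ` \<sigma> ` C)"
    using l(2) tilingD(1)[OF V t'(1)] finite_C by (auto intro!: order_trans[OF l(2)] Max_ge)
  finally show "ahead t \<le> Max (length ` \<sigma> ` C)" .
qed

lemma aheadI:
  assumes "t + int l \<in> fst ` V" "\<And>j. j < l \<Longrightarrow> t + int j \<notin> fst ` V"
  shows "ahead t = l"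
  unfolding ahead_def by (rule Least_equality) (use assms not_le in blast)+

lemma state_Nil: "state t = [] \<longleftrightarrow> t \<in> fst ` V"
  using ahead(1)[of t] ahead(2)[of 0 t] by (cases "ahead t = 0") (auto simp: state_def)

lemma finite_states: "finite (range state)"
proof (rule finite_subset)
  let ?B = "\<Union>c\<in>C. set (\<sigma> c)"
  have "y s \<in> ?B" for s
  proof -
    obtain t c where t: "(t, c) \<in> U" "t \<le> s" "s < t + int (length (\<sigma> c))"
      using tiling_cover[OF U] by blast
    then have "y s = \<sigma> c ! nat (s - t)" using tilingD(3)[OF U t(1), of "nat (s - t)"] by simp
    moreover have "\<sigma> c ! nat (s - t) \<in> set (\<sigma> c)" using t by (intro nth_mem) auto
    ultimately show ?thesis using tilingD(1)[OF U t(1)] by auto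
  qed
  then show "range state \<subseteq>
      {xs. set xs \<subseteq> ?B \<times> UNIV \<and> length xs \<le> Max (length ` \<sigma> ` C)}"
    using ahead(3) by (auto simp: state_def)
  show "finite \<dots>" using finite_C by (intro finite_lists_length_le) auto
qed

lemma state_eqD:
  assumes "state t1 = state t2"
  shows "ahead t2 = ahead t1" "agree y Q t1 t2 (ahead t1)"
proof -
  show a: "ahead t2 = ahead t1" using arg_cong[OF assms, of length] by (simp add: state_def)
  have "y (t1 + int j) = y (t2 + int j) \<and> (t1 + int j \<in> Q \<longleftrightarrow> t2 + int j \<in> Q)"
    if "j < ahead t1" for j
    using arg_cong[OF assms, of "\<lambda>l. l ! j"] that a by (simp add: state_def)
  then show "agree y Q t1 t2 (ahead t1)" by (simp add: agree_def)
qed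

text \<open>While the cut \<open>m\<close> of \<open>V\<close> lies before \<open>n\<close>, the
  window from \<open>m\<close> to \<open>n\<close> ends at cuts, so by \<open>same_letter\<close>
  equal blocks of \<open>V\<close> start at both places and push \<open>m\<close> forward. The last
  hypothesis makes the final \<open>m\<close> the first cut of \<open>V\<close> at or after
  \<open>n\<close>.\<close>

lemma extend_agreement:
  assumes "t1 + int n \<in> Q" "t2 + int n \<in> Q" "agree y Q t1 t2 n"
    and "t1 + int m \<in> fst ` V" "t2 + int m \<in> fst ` V" "agree y Q t1 t2 m"
    and "\<And>j. n \<le> j \<Longrightarrow> j < m \<Longrightarrow> t1 + int j \<notin> fst ` V \<and> t2 + int j \<notin> fst ` V"
  shows "\<exists>m\<ge>n. t1 + int m \<in> fst ` V \<and> t2 + int m \<in> fst ` V \<and> agree y Q t1 t2 m \<and>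
    (\<forall>j. n \<le> j \<longrightarrow> j < m \<longrightarrow> t1 + int j \<notin> fst ` V \<and> t2 + int j \<notin> fst ` V)"
  using assms(4-7)
proof (induction "n - m" arbitrary: m rule: less_induct)
  case less
  show ?case
  proof (cases "n \<le> m")
    case True
    then show ?thesis using less.prems by blast
  next
    case False
    obtain d1 d2 where d1: "(t1 + int m, d1) \<in> V" and d2: "(t2 + int m, d2) \<in> V"
      using less.prems by auto
    have "agree y Q (t1 + int m) (t2 + int m) (n - m)"
      unfolding agree_def
    proof (intro allI impI)
      fix i assume "i < n - m"
      then have "m + i < n" by simp
      then have "y (t1 + int (m + i)) = y (t2 + int (m + i)) \<and>
          (t1 + int (m + i) \<in> Q \<longleftrightarrow> t2 + int (m + i) \<in> Q)"
        using assms(3) unfolding agree_def by blast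
      then show "y (t1 + int m + int i) = y (t2 + int m + int i) \<and>
          (t1 + int m + int i \<in> Q \<longleftrightarrow> t2 + int m + int i \<in> Q)"
        by (simp add: add.assoc)
    qed
    then have "d1 = d2"
      using same_letter[of "t1 + int m" d1 "t2 + int m" d2 "n - m"] d1 d2 assms(1,2) False
      by (simp add: of_nat_diff)
    then have d2: "(t2 + int m, d1) \<in> V" using d2 by simp
    define l where "l = length (\<sigma> d1)"
    have l: "l > 0" using tilingD(2)[OF V d1] by (simp add: l_def)
    have "t1 + int (m + l) \<in> fst ` V" "t2 + int (m + l) \<in> fst ` V"
      using tiling_next[OF V d1] tiling_next[OF V d2] by (force simp: l_def add.assoc)+
    moreover have "agree y Q t1 t2 (m + l)"
      unfolding agree_def
    proof (intro allI impI)
      fix j assume j: "j < m + l"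
      show "y (t1 + int j) = y (t2 + int j) \<and> (t1 + int j \<in> Q \<longleftrightarrow> t2 + int j \<in> Q)"
      proof (cases "j < m")
        case True
        then show ?thesis using less.prems(3) by (simp add: agree_def)
      next
        case False
        have "agree y Q (t1 + int m) (t2 + int m) l"
          using block_agree[OF Q, of "t1 + int m" d1 "t2 + int m"] d1 d2 by (simp add: l_def)
        moreover have "j - m < l" using j False by simp
        ultimately have "y (t1 + int m + int (j - m)) = y (t2 + int m + int (j - m)) \<and>
            (t1 + int m + int (j - m) \<in> Q \<longleftrightarrow> t2 + int m + int (j - m) \<in> Q)"
          unfolding agree_def by blast
        then show ?thesis using False by (simp add: of_nat_diff)
      qed
    qed
    \<comment> \<open>Such a \<open>j\<close> lies strictly inside the block just added, which
      starts at \<open>m < n\<close>.\<close>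
    moreover have "t1 + int j \<notin> fst ` V \<and> t2 + int j \<notin> fst ` V" if "n \<le> j" "j < m + l" for j
    proof -
      have no: "t + int j \<notin> fst ` V" if d: "(t + int m, d1) \<in> V" for t
      proof
        assume "t + int j \<in> fst ` V"
        then obtain e where e: "(t + int j, e) \<in> V" by auto
        have "t + int m = t + int j"
          using tiling_unique(1)[OF V d e, of "t + int j"] tilingD(2)[OF V e] \<open>n \<le> j\<close> \<open>j < m + l\<close>
            False by (simp add: l_def)
        then show False using \<open>n \<le> j\<close> False by simp
      qed
      show ?thesis using no[OF d1] no[OF d2] by simp
    qed
    moreover have "n - (m + l) < n - m" using l False by simp
    ultimately show ?thesis using less.hyps[of "m + l"] by blast
  qed
qed

text \<open>A non-empty overlap ends at a cut, so it contains the first piece of the block of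
  \<open>U\<close> and determines its letter. Both places then agree to the end of this block, and
  \<open>extend_agreement\<close> reaches the next cut of \<open>V\<close>.\<close>

lemma state_step:
  assumes u: "(t1, c1) \<in> U" "(t2, c2) \<in> U" and st: "state t1 = state t2" "state t1 \<noteq> []"
  shows "c1 = c2" "state (t1 + int (length (\<sigma> c1))) = state (t2 + int (length (\<sigma> c2)))"
proof -
  define l where "l = ahead t1"
  have l: "l > 0" using st(2) by (simp add: state_def l_def)
  have a: "ahead t2 = l" "agree y Q t1 t2 l" using state_eqD[OF st(1)] by (auto simp: l_def)
  have e: "t1 + int l \<in> fst ` V" "t2 + int l \<in> fst ` V"
    using ahead(1)[of t1] ahead(1)[of t2] a by (auto simp: l_def)
  have eQ: "t1 + int l \<in> Q" "t2 + int l \<in> Q" using e by (metis Un_iff imageE prod.collapse start_in[OF Q])+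
  show c: "c1 = c2" using same_letter[of t1 c1 t2 c2 l] u a l eQ by simp
  define n where "n = length (\<sigma> c1)"
  have "\<exists>m\<ge>n. t1 + int m \<in> fst ` V \<and> t2 + int m \<in> fst ` V \<and> agree y Q t1 t2 m \<and>
    (\<forall>j. n \<le> j \<longrightarrow> j < m \<longrightarrow> t1 + int j \<notin> fst ` V \<and> t2 + int j \<notin> fst ` V)"
  proof (rule extend_agreement[where m = l])
    show "t1 + int n \<in> Q" "t2 + int n \<in> Q"
      using end_in[OF Q, of t1 c1] end_in[OF Q, of t2 c1] u c by (auto simp: n_def)
    show "agree y Q t1 t2 n" using block_agree[OF Q, of t1 c1 t2] u c by (simp add: n_def)
    show "t1 + int j \<notin> fst ` V \<and> t2 + int j \<notin> fst ` V" if "j < l" for j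
      using ahead(2)[of j t1] ahead(2)[of j t2] that a by (simp add: l_def)
  qed (use a e in auto)
  then obtain m where m: "n \<le> m" "t1 + int m \<in> fst ` V" "t2 + int m \<in> fst ` V" "agree y Q t1 t2 m"
    "\<And>j. n \<le> j \<Longrightarrow> j < m \<Longrightarrow> t1 + int j \<notin> fst ` V \<and> t2 + int j \<notin> fst ` V" by blast
  have no: "t1 + int n + int j \<notin> fst ` V \<and> t2 + int n + int j \<notin> fst ` V" if "j < m - n" for j
    using m(5)[of "n + j"] that by (simp add: add.assoc)
  have "ahead (t1 + int n) = m - n" by (rule aheadI) (use m(1,2) no in \<open>simp_all add: of_nat_diff\<close>)
  moreover have "ahead (t2 + int n) = m - n"
    by (rule aheadI) (use m(1,3) no in \<open>simp_all add: of_nat_diff\<close>)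
  moreover have "y (t1 + int n + int j) = y (t2 + int n + int j) \<and>
      (t1 + int n + int j \<in> Q \<longleftrightarrow> t2 + int n + int j \<in> Q)" if "j < m - n" for j
  proof -
    have "n + j < m" using that by simp
    then have "y (t1 + int (n + j)) = y (t2 + int (n + j)) \<and>
        (t1 + int (n + j) \<in> Q \<longleftrightarrow> t2 + int (n + j) \<in> Q)"
      using m(4) unfolding agree_def by blast
    then show ?thesis by (simp add: add.assoc)
  qed
  ultimately show "state (t1 + int (length (\<sigma> c1))) = state (t2 + int (length (\<sigma> c2)))"
    unfolding state_def c[symmetric] n_def[symmetric] by simp
qed

text \<open>At a common cut both blocks begin with the same piece, hence carry the same
  letter.\<close>

lemma common_start:
  assumes "(t, c) \<in> U" "t \<in> fst ` V"
  shows "(t, c) \<in> V" "t + int (length (\<sigma> c)) \<in> fst ` V"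
proof -
  obtain d where d: "(t, d) \<in> V" using assms by auto
  obtain w where w: "piece y Q t w" using piece_at[OF Q start_in[OF Q, of t d]] d by blast
  have "c = d" using inj[OF _ _ w w] assms(1) d by simp
  with d show "(t, c) \<in> V" by simp
  then show "t + int (length (\<sigma> c)) \<in> fst ` V" using tiling_next[OF V] by force
qed

text \<open>Along \<open>U\<close> each overlap determines the next, so their sequence is purely
  periodic. If one overlap is empty, all are, and the tilings coincide. Otherwise each overlap also
  determines the letter, so the letters and with them \<open>y\<close> are periodic.\<close>

lemma tilings_eq_or_periodic: "U = V \<or> periodic y"
proof -
  obtain p :: "int \<Rightarrow> int" and x where px: "U = range (\<lambda>i. (p i, x i))"
    "\<And>i. p (i + 1) = p i + int (length (\<sigma> (x i)))"
    using tiling_enumeration[OF U] by auto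
  have in_U: "(p i, x i) \<in> U" for i using px(1) by auto
  define s where "s i = state (p i)" for i
  have det: "s (i + 1) = s (k + 1)" if "s i = s k" for i k
  proof (cases "s i = []")
    case True
    then have "p i \<in> fst ` V" "p k \<in> fst ` V" using that state_Nil by (metis s_def)+
    then have "p (i + 1) \<in> fst ` V" "p (k + 1) \<in> fst ` V"
      using common_start(2)[OF in_U] by (simp_all add: px(2))
    then show ?thesis using state_Nil by (metis s_def)
  next
    case False
    then show ?thesis using state_step(2)[OF in_U[of i] in_U[of k]] that unfolding s_def px(2) by blast
  qed
  have fin: "finite (range s)" using finite_states by (rule finite_subset[rotated]) (auto simp: s_def)
  obtain m :: nat where m: "m > 0" "\<And>i. s (i + int m) = s i"
    using deterministic_imp_periodic[OF fin det] by auto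
  show ?thesis
  proof (cases "\<exists>i. s i = []")
    case True
    then obtain i where i: "s i = []" by blast
    have up: "s (i + int n) = []" for n
    proof (induction n)
      case (Suc n)
      have "p (i + int n) \<in> fst ` V" using Suc state_Nil by (simp add: s_def)
      then have "p (i + int n + 1) \<in> fst ` V" using common_start(2)[OF in_U] by (simp add: px(2))
      then have "s (i + int n + 1) = []" using state_Nil by (simp add: s_def)
      then show ?case by (simp add: ac_simps)
    qed (use i in simp)
    have shift: "s (j + int (n * m)) = s j" for j n
    proof (induction n)
      case (Suc n)
      then show ?case using m(2)[of "j + int (n * m)"] by (simp add: algebra_simps)
    qed simp
    \<comment> \<open>Emptiness spreads only to the right; an index left of \<open>i\<close> is
      first moved beyond \<open>i\<close> by a multiple of the period \<open>m\<close>.\<close>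
    have all: "s j = []" for j
    proof -
      define n where "n = nat \<bar>i - j\<bar>"
      have "n \<le> n * m" using m(1) by simp
      then have "int n \<le> int (n * m)" by (simp only: of_nat_le_iff)
      moreover have "i - j \<le> int n" by (simp add: n_def)
      ultimately have "i \<le> j + int (n * m)" by linarith
      then have "j + int (n * m) = i + int (nat (j + int (n * m) - i))" by simp
      then have "s (j + int (n * m)) = []" using up by metis
      then show ?thesis using shift by simp
    qed
    have sub: "U \<subseteq> V"
    proof
      fix u assume "u \<in> U"
      then obtain j where "u = (p j, x j)" using px by auto
      moreover have "p j \<in> fst ` V" using all[of j] state_Nil by (simp add: s_def)
      ultimately show "u \<in> V" using common_start(1)[OF in_U] by simp
    qed
    have "V \<subseteq> U"
    proof
      fix v assume v: "v \<in> V"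
      obtain t c where t: "(t, c) \<in> U" "t \<le> fst v" "fst v < t + int (length (\<sigma> c))"
        using tiling_cover[OF U] by blast
      have "t = fst v" "c = snd v"
        using tiling_unique[OF V, of t c "fst v" "snd v" "fst v"] t sub v
          tilingD(2)[OF V, of "fst v" "snd v"] by auto
      with t show "v \<in> U" by simp
    qed
    with sub show ?thesis by blast
  next
    case False
    have x: "x (i + int m) = x i" for i
      using state_step(1)[OF in_U[of "i + int m"] in_U[of i]] m(2)[of i] False unfolding s_def by metis
    \<comment> \<open>The total image length of one period of letters, which becomes a period of
      \<open>y\<close>.\<close>
    define d where "d = p (int m) - p 0"
    have d: "p (i + int m) = p i + d" for i
    proof (induction i rule: int_induct[where k = 0])
      case base
      then show ?case by (simp add: d_def)
    next
      case (step1 i)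
      have "p (i + 1 + int m) = p (i + int m) + int (length (\<sigma> (x (i + int m))))"
        using px(2)[of "i + int m"] by (simp add: ac_simps)
      with step1 show ?case using px(2)[of i] x[of i] by simp
    next
      case (step2 i)
      have "p (i + int m) = p (i - 1 + int m) + int (length (\<sigma> (x (i - 1 + int m))))"
        using px(2)[of "i - 1 + int m"] by (simp add: ac_simps)
      with step2 show ?case using px(2)[of "i - 1"] x[of "i - 1"] by simp
    qed
    have inc: "p i < p (i + 1)" for i using px(2)[of i] tilingD(2)[OF U in_U[of i]] by simp
    have "p 0 < p (int (Suc n))" for n
    proof (induction n)
      case (Suc n)
      then show ?case using inc[of "int (Suc n)"] by (simp add: ac_simps)
    qed (use inc[of 0] in simp)
    from this[of "m - 1"] have "d \<ge> 1" using m(1) by (simp add: d_def)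
    moreover have "y (r + d) = y r" for r
    proof -
      obtain i where i: "p i \<le> r" "r < p (i + 1)" using strict_increasing_cover[of p r] inc by blast
      define j where "j = nat (r - p i)"
      have j: "j < length (\<sigma> (x i))" "r = p i + int j" using i px(2)[of i] by (auto simp: j_def)
      have "y (p (i + int m) + int j) = \<sigma> (x i) ! j"
        using tilingD(3)[OF U in_U[of "i + int m"], of j] j x by simp
      then show ?thesis using tilingD(3)[OF U in_U[of i] j(1)] d j(2) by (simp add: ac_simps)
    qed
    ultimately have "periodic y" unfolding periodic_def shift_def by blast
    then show ?thesis ..
  qed
qed

end

end

theorem elementary_tiling_unique:
  assumes "finite C" "elementary \<sigma> C" "tiling \<sigma> C y U" "tiling \<sigma> C y V" "aperiodic y"
  shows "U = V"
proof -
  interpret two_tilings \<sigma> C y U V using assms by unfold_locales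
  \<comment> \<open>Cutting everywhere is compatible, so a compatible set with fewest relative cuts
    exists.\<close>
  have "compatible UNIV" by (simp add: compatible_def)
  then obtain Q where Q: "compatible Q"
    "\<And>Q'. compatible Q' \<Longrightarrow> card (relative_cuts Q) \<le> card (relative_cuts Q')"
    using ex_has_least_nat[of compatible UNIV "\<lambda>Q. card (relative_cuts Q)"] by blast
  have "U = V \<or> periodic y"
    by (rule tilings_eq_or_periodic[OF Q(1)]) (rule first_piece_inj[OF Q assms(2)])
  with assms(5) show ?thesis by blast
qed

section \<open>Compactness\<close>

text \<open>Compactness of the power set of a countable set: a diagonal subsequence of
  \<open>T\<close> converges pointwise to \<open>Z\<close>. The conclusion records agreement on
  finite windows at arbitrarily late stages.\<close>

lemma finite_window_limit:
  fixes T :: "nat \<Rightarrow> 'u set"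
  assumes "countable S"
  obtains Z where "Z \<subseteq> S"
    and "\<And>W n. finite W \<Longrightarrow> W \<subseteq> S \<Longrightarrow> \<exists>J\<ge>n. \<forall>u\<in>W. u \<in> T J \<longleftrightarrow> u \<in> Z"
proof -
  define e where "e = from_nat_into S"
  define P where "P n r \<longleftrightarrow> (\<forall>i j. e n \<in> T (r i) \<longleftrightarrow> e n \<in> T (r j))" for n and r :: "nat \<Rightarrow> nat"
  interpret subseqs P
  proof
    fix n and s :: "nat \<Rightarrow> nat" assume "strict_mono s"
    define I where "I = {j. e n \<in> T (s j)}"
    have "infinite I \<or> infinite (- I)" by (metis Compl_partition finite_Un infinite_UNIV_nat)
    then obtain r :: "nat \<Rightarrow> nat" where r: "strict_mono r" "(\<forall>j. r j \<in> I) \<or> (\<forall>j. r j \<in> - I)"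
      using infinite_enumerate[of I] infinite_enumerate[of "- I"] by blast
    then have "P n (s \<circ> r)" unfolding P_def I_def by auto
    with r show "\<exists>r'. strict_mono r' \<and> P n (s \<circ> r')" by blast
  qed
  have P: "P k (diagseq \<circ> (+) (Suc k))" for k
    by (rule diagseq_holds) (auto simp: P_def)
  define Z where "Z = {u \<in> S. \<forall>\<^sub>F j in sequentially. u \<in> T (diagseq j)}"
  have ev: "\<forall>\<^sub>F j in sequentially. u \<in> T (diagseq j) \<longleftrightarrow> u \<in> Z" if uS: "u \<in> S" for u
  proof -
    obtain k where k: "e k = u" unfolding e_def
      using from_nat_into_surj[OF assms uS] by blast
    define c where "c = (u \<in> T (diagseq (Suc k)))"
    have c: "u \<in> T (diagseq j) \<longleftrightarrow> c" if "j \<ge> Suc k" for j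
    proof -
      have "u \<in> T ((diagseq \<circ> (+) (Suc k)) (j - Suc k)) \<longleftrightarrow> u \<in> T ((diagseq \<circ> (+) (Suc k)) 0)"
        using P[of k] unfolding P_def k by blast
      then show ?thesis using that by (simp add: c_def)
    qed
    then have ev_c: "\<forall>\<^sub>F j in sequentially. u \<in> T (diagseq j) \<longleftrightarrow> c"
      using eventually_sequentially by blast
    have "u \<in> Z \<longleftrightarrow> c"
    proof (cases c)
      case True
      then show ?thesis using ev_c uS unfolding Z_def by simp
    next
      case False
      have "\<not> (\<forall>\<^sub>F j in sequentially. u \<in> T (diagseq j))"
      proof
        assume "\<forall>\<^sub>F j in sequentially. u \<in> T (diagseq j)"
        with ev_c have "\<forall>\<^sub>F j in sequentially. False" by eventually_elim (use False in simp)
        then show False by simp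
      qed
      then show ?thesis using False unfolding Z_def by simp
    qed
    then show ?thesis using ev_c by simp
  qed
  have "\<exists>J\<ge>n. \<forall>u\<in>W. u \<in> T J \<longleftrightarrow> u \<in> Z" if "finite W" "W \<subseteq> S" for W n
  proof -
    have "\<forall>\<^sub>F j in sequentially. \<forall>u\<in>W. u \<in> T (diagseq j) \<longleftrightarrow> u \<in> Z"
      using that ev by (intro eventually_ball_finite) auto
    then obtain N where N: "\<forall>j\<ge>N. \<forall>u\<in>W. u \<in> T (diagseq j) \<longleftrightarrow> u \<in> Z"
      unfolding eventually_sequentially by blast
    have "n \<le> diagseq (max n N)" using seq_suble[OF subseq_diagseq, of "max n N"] by simp
    with N show ?thesis by (intro exI[of _ "diagseq (max n N)"]) simp
  qed
  moreover have "Z \<subseteq> S" unfolding Z_def by blast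
  ultimately show ?thesis using that by blast
qed

section \<open>From finite factorizations to a tiling of the whole sequence\<close>

fun tiles :: "int \<Rightarrow> 'a list list \<Rightarrow> (int \<times> 'a list) set" where
  "tiles a [] = {}"
| "tiles a (f # fs) = insert (a, f) (tiles (a + int (length f)) fs)"

lemma tilesD:
  assumes "(t, f) \<in> tiles a fs"
  shows "a \<le> t \<and> f \<in> set fs \<and>
    (\<forall>j<length f. nat (t - a) + j < length (concat fs) \<and> concat fs ! (nat (t - a) + j) = f ! j)"
  using assms
proof (induction fs arbitrary: a)
  case (Cons g fs)
  consider "t = a" "f = g" | "(t, f) \<in> tiles (a + int (length g)) fs" using Cons.prems by auto
  then show ?case
  proof cases
    case 1
    then show ?thesis by (simp add: nth_append)
  next
    case 2
    have IH: "a + int (length g) \<le> t" "f \<in> set fs"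
      "\<And>j. j < length f \<Longrightarrow> nat (t - (a + int (length g))) + j < length (concat fs) \<and>
        concat fs ! (nat (t - (a + int (length g))) + j) = f ! j"
      using Cons.IH[OF 2] by auto
    have eq: "nat (t - a) = length g + nat (t - (a + int (length g)))" using IH(1) by simp
    show ?thesis unfolding eq using IH by (simp add: nth_append)
  qed
qed simp

lemma tiles_cover:
  assumes "[] \<notin> set fs" "a \<le> s" "s < a + int (length (concat fs))"
  shows "\<exists>!u. u \<in> tiles a fs \<and> fst u \<le> s \<and> s < fst u + int (length (snd u))"
  using assms
proof (induction fs arbitrary: a)
  case (Cons g fs)
  have later: "a + int (length g) \<le> t" if "(t, f) \<in> tiles (a + int (length g)) fs" for t f
    using tilesD[OF that] by simp
  show ?case
  proof (cases "s < a + int (length g)")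
    case True
    then show ?thesis using Cons.prems later
      by (intro ex1I[of _ "(a, g)"]) force+
  next
    case False
    then have "\<exists>!u. u \<in> tiles (a + int (length g)) fs \<and> fst u \<le> s \<and> s < fst u + int (length (snd u))"
      using Cons.prems by (intro Cons.IH) auto
    then show ?thesis using False by (metis fst_conv insert_iff snd_conv tiles.simps(2))
  qed
qed simp

text \<open>Factorizations of ever longer central windows give partial tilings. Each instance of the
  tiling condition involves finitely many candidate blocks, so it passes to a limit.\<close>

lemma tiling_by_compactness:
  fixes x :: "int \<Rightarrow> 'a"
  assumes F: "finite F" "[] \<notin> F"
    and sub: "\<And>J. \<exists>fs\<in>lists F. sublist (map (\<lambda>j. x (- int J + int j)) [0..<2 * J]) (concat fs)"
  shows "\<exists>Z. tiling (\<lambda>w. w) F x Z"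
proof -
  \<comment> \<open>Blocks may stick out of the window, so their letters are compared with
    \<open>x\<close> only inside it.\<close>
  define good where "good J T \<longleftrightarrow>
    (\<forall>(t, f)\<in>T. f \<in> F \<and> (\<forall>j<length f. - int J \<le> t + int j \<longrightarrow> t + int j < int J \<longrightarrow> x (t + int j) = f ! j)) \<and>
    (\<forall>s. - int J \<le> s \<longrightarrow> s < int J \<longrightarrow>
      (\<exists>!u. u \<in> T \<and> fst u \<le> s \<and> s < fst u + int (length (snd u))))" for J T
  have "\<exists>T. good J T" for J
  proof -
    obtain fs p q where fs: "fs \<in> lists F"
      "concat fs = p @ map (\<lambda>j. x (- int J + int j)) [0..<2 * J] @ q"
      using sub[of J] unfolding sublist_def by blast
    define a where "a = - int J - int (length p)"
    have "good J (tiles a fs)"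
      unfolding good_def
    proof (intro conjI allI impI ballI, clarify)
      fix t f assume tf: "(t, f) \<in> tiles a fs"
      note D = tilesD[OF tf]
      have "x (t + int j) = f ! j"
        if j: "j < length f" "- int J \<le> t + int j" "t + int j < int J" for j
      proof -
        define i where "i = nat (t + int j + int J)"
        have i: "nat (t - a) + j = length p + i" "i < 2 * J" "t + int j = - int J + int i"
          using D j unfolding a_def i_def by auto
        have "f ! j = concat fs ! (length p + i)" using D j(1) i(1) by metis
        also have "\<dots> = x (- int J + int i)" unfolding fs(2) using i(2) by (simp add: nth_append)
        finally show ?thesis using i(3) by simp
      qed
      then show "f \<in> F \<and> (\<forall>j<length f. - int J \<le> t + int j \<longrightarrow> t + int j < int J \<longrightarrow>
          x (t + int j) = f ! j)" using D fs(1) by auto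
    next
      fix s assume s: "- int J \<le> s" "s < int J"
      show "\<exists>!u. u \<in> tiles a fs \<and> fst u \<le> s \<and> s < fst u + int (length (snd u))"
        using fs F(2) s by (intro tiles_cover) (auto simp: a_def)
    qed
    then show ?thesis by blast
  qed
  then obtain T where T: "\<And>J. good J (T J)" by metis
  define S where "S = (UNIV :: int set) \<times> F"
  have "countable S" unfolding S_def using F(1) by (intro countable_SIGMA) (auto simp: countable_finite)
  then obtain Z where Z: "Z \<subseteq> S"
    "\<And>W n. finite W \<Longrightarrow> W \<subseteq> S \<Longrightarrow> \<exists>J\<ge>n. \<forall>u\<in>W. u \<in> T J \<longleftrightarrow> u \<in> Z"
    using finite_window_limit[of S T] by metis
  have "f \<in> F \<and> f \<noteq> [] \<and> (\<forall>j<length f. x (t + int j) = f ! j)" if tf: "(t, f) \<in> Z" for t f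
  proof -
    obtain J where J: "J \<ge> nat \<bar>t\<bar> + length f + 1" "(t, f) \<in> T J"
      using Z(2)[of "{(t, f)}" "nat \<bar>t\<bar> + length f + 1"] Z(1) tf by auto
    have "f \<in> F" using tf Z(1) unfolding S_def by auto
    moreover have "x (t + int j) = f ! j" if "j < length f" for j
      using T[of J] J that unfolding good_def by fastforce
    ultimately show ?thesis using F(2) by auto
  qed
  moreover have "\<exists>!u. u \<in> Z \<and> fst u \<le> s \<and> s < fst u + int (length (snd u))" for s
  proof -
    \<comment> \<open>All blocks that can cover \<open>s\<close>: they start at most the maximal
      block length before it.\<close>
    define W where "W = {s - int (Max (length ` F))..s} \<times> F"
    have W: "finite W" "W \<subseteq> S" unfolding W_def S_def using F(1) by auto
    then obtain J where J: "J \<ge> nat \<bar>s\<bar> + 1" "\<forall>u\<in>W. u \<in> T J \<longleftrightarrow> u \<in> Z"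
      using Z(2)[of W "nat \<bar>s\<bar> + 1"] by auto
    have inW: "u \<in> W" if "snd u \<in> F" "fst u \<le> s" "s < fst u + int (length (snd u))" for u
    proof -
      have "length (snd u) \<le> Max (length ` F)" using F(1) that by (intro Max_ge) auto
      then show ?thesis using that unfolding W_def by (cases u) auto
    qed
    have TF: "snd u \<in> F" if "u \<in> T J" for u
      using T[of J] that unfolding good_def by (cases u) auto
    have ZF: "snd u \<in> F" if "u \<in> Z" for u using that Z(1) unfolding S_def by auto
    have "\<exists>!u. u \<in> T J \<and> fst u \<le> s \<and> s < fst u + int (length (snd u))"
      using T[of J] J(1) unfolding good_def by simp
    moreover have "u \<in> T J \<and> fst u \<le> s \<and> s < fst u + int (length (snd u)) \<longleftrightarrow>
        u \<in> Z \<and> fst u \<le> s \<and> s < fst u + int (length (snd u))" for u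
      using inW TF ZF J(2) by blast
    ultimately show ?thesis by simp
  qed
  ultimately have "tiling (\<lambda>w. w) F x Z" unfolding tiling_def by auto
  then show ?thesis by blast
qed

section \<open>Representations as tilings\<close>

lemma cut_strict:
  assumes "\<And>i. \<sigma> (x i) \<noteq> []"
  shows "cut \<sigma> x i < cut \<sigma> x (i + 1)"
  using assms[of i] by (simp add: cut_step)

lemma cut_strict_mono:
  assumes "\<And>i. \<sigma> (x i) \<noteq> []" "i < j"
  shows "cut \<sigma> x i < cut \<sigma> x j"
  using cut_strict[of \<sigma> x i, OF assms(1)] cut_mono[of "i + 1" j \<sigma> x] assms(2) by simp

lemma word_ext_snoc [simp]: "word_ext \<sigma> (w @ [a]) = word_ext \<sigma> w @ \<sigma> a"
  by (simp add: word_ext_def)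

lemma cut_word:
  "cut \<sigma> x (t + int l) = cut \<sigma> x t + int (length (word_ext \<sigma> (map (\<lambda>j. x (t + int j)) [0..<l])))"
proof (induction l)
  case 0
  then show ?case by (simp add: word_ext_def)
next
  case (Suc l)
  then show ?case using cut_step[of \<sigma> x "t + int l"] by (simp add: ac_simps)
qed

lemma seq_ext_word:
  assumes "j < length (word_ext \<sigma> (map (\<lambda>j. x (t + int j)) [0..<l]))"
  shows "seq_ext \<sigma> x (cut \<sigma> x t + int j) = word_ext \<sigma> (map (\<lambda>j. x (t + int j)) [0..<l]) ! j"
  using assms
proof (induction l)
  case 0
  then show ?case by (simp add: word_ext_def)
next
  case (Suc l)
  let ?w = "word_ext \<sigma> (map (\<lambda>j. x (t + int j)) [0..<l])"
  show ?case
  proof (cases "j < length ?w")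
    case True
    then show ?thesis using Suc.IH by (simp add: nth_append)
  next
    case False
    have e: "cut \<sigma> x t + int j = cut \<sigma> x (t + int l) + int (j - length ?w)"
      using False cut_word[of \<sigma> x t l] by simp
    have "seq_ext \<sigma> x (cut \<sigma> x t + int j) = \<sigma> (x (t + int l)) ! (j - length ?w)"
      unfolding e by (rule seq_ext_block) (use Suc.prems False in simp)
    then show ?thesis using False by (simp add: nth_append)
  qed
qed

text \<open>The term \<open>- k\<close> accounts for the shift of the image by \<open>k\<close>.
  Labels remain words, so that they can be read as letters of
  \<open>word_ext \<sigma>\<close>.\<close>

definition cut_tiles :: "('a \<Rightarrow> 'b list) \<Rightarrow> (int \<Rightarrow> 'a) \<Rightarrow> int \<Rightarrow> (int \<times> 'c) set \<Rightarrow> (int \<times> 'c) set" where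
  "cut_tiles \<sigma> x k Z = (\<lambda>(t, f). (cut \<sigma> x t - k, f)) ` Z"

lemma tile_word:
  assumes "tiling (\<lambda>w. w) F x Z" "(t, f) \<in> Z" "l \<le> length f"
  shows "map (\<lambda>j. x (t + int j)) [0..<l] = take l f"
  using tilingD(3)[OF assms(1,2)] assms(3) by (intro nth_equalityI) auto

text \<open>Let \<open>\<sigma> (x i)\<close> contain position \<open>s + k\<close> of
  \<open>seq_ext \<sigma> x\<close>. As \<open>cut\<close> is increasing, the image of a block
  covers \<open>s\<close> exactly when the block covers \<open>i\<close>, so unique covering carries
  over from \<open>x\<close>.\<close>

lemma tiling_word_ext:
  assumes ne: "\<And>i. \<sigma> (x i) \<noteq> []" and Z: "tiling (\<lambda>w. w) F x Z"
  shows "tiling (word_ext \<sigma>) F (shift k (seq_ext \<sigma> x)) (cut_tiles \<sigma> x k Z)"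
proof -
  have end_cut: "cut \<sigma> x (t + int (length f)) = cut \<sigma> x t + int (length (word_ext \<sigma> f))"
    if "(t, f) \<in> Z" for t f
    using cut_word[of \<sigma> x t "length f"] tile_word[OF Z that, of "length f"] by simp
  have block: "f \<in> F \<and> word_ext \<sigma> f \<noteq> [] \<and> (\<forall>j<length (word_ext \<sigma> f).
      shift k (seq_ext \<sigma> x) (cut \<sigma> x t - k + int j) = word_ext \<sigma> f ! j)"
    if tf: "(t, f) \<in> Z" for t f
  proof (intro conjI allI impI)
    show "f \<in> F" using tilingD(1)[OF Z tf] .
    have "cut \<sigma> x t < cut \<sigma> x (t + int (length f))"
      using cut_strict_mono[of \<sigma> x, OF ne] tilingD(2)[OF Z tf] by simp
    then show "word_ext \<sigma> f \<noteq> []" using end_cut[OF tf] by auto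
    fix j assume "j < length (word_ext \<sigma> f)"
    then show "shift k (seq_ext \<sigma> x) (cut \<sigma> x t - k + int j) = word_ext \<sigma> f ! j"
      using seq_ext_word[of j \<sigma> x t "length f"] tile_word[OF Z tf, of "length f"]
      by (simp add: shift_def algebra_simps)
  qed
  have covers: "cut \<sigma> x t - k \<le> s \<and> s < cut \<sigma> x t - k + int (length (word_ext \<sigma> f)) \<longleftrightarrow>
      t \<le> i \<and> i < t + int (length f)"
    if tf: "(t, f) \<in> Z" and i: "cut \<sigma> x i \<le> s + k" "s + k < cut \<sigma> x (i + 1)" for t f s i
  proof -
    have "t \<le> i \<longleftrightarrow> cut \<sigma> x t \<le> s + k"
      using i cut_mono[of t i \<sigma> x] cut_mono[of "i + 1" t \<sigma> x] by linarith
    moreover have "t + int (length f) \<le> i \<longleftrightarrow> cut \<sigma> x (t + int (length f)) \<le> s + k"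
      using i cut_mono[of "t + int (length f)" i \<sigma> x] cut_mono[of "i + 1" "t + int (length f)" \<sigma> x]
      by linarith
    ultimately show ?thesis using end_cut[OF tf] by linarith
  qed
  have "\<exists>!u. u \<in> cut_tiles \<sigma> x k Z \<and> fst u \<le> s \<and> s < fst u + int (length (word_ext \<sigma> (snd u)))" for s
  proof -
    obtain i where i: "cut \<sigma> x i \<le> s + k" "s + k < cut \<sigma> x (i + 1)"
      using strict_increasing_cover[of "cut \<sigma> x" "s + k"] cut_strict[of \<sigma> x, OF ne] by blast
    obtain t f where tf: "(t, f) \<in> Z" "t \<le> i" "i < t + int (length f)"
      using tiling_cover[OF Z] by blast
    show ?thesis
    proof (rule ex1I[of _ "(cut \<sigma> x t - k, f)"])
      show "(cut \<sigma> x t - k, f) \<in> cut_tiles \<sigma> x k Z \<and> fst (cut \<sigma> x t - k, f) \<le> s \<and>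
          s < fst (cut \<sigma> x t - k, f) + int (length (word_ext \<sigma> (snd (cut \<sigma> x t - k, f))))"
        using covers[OF tf(1) i] tf by (auto simp: cut_tiles_def)
      fix u
      assume u: "u \<in> cut_tiles \<sigma> x k Z \<and> fst u \<le> s \<and> s < fst u + int (length (word_ext \<sigma> (snd u)))"
      then obtain t' f' where t': "(t', f') \<in> Z" "u = (cut \<sigma> x t' - k, f')"
        by (auto simp: cut_tiles_def)
      then have "t' \<le> i" "i < t' + int (length f')" using covers[OF t'(1) i] u by auto
      then have "t' = t" "f' = f" using tiling_unique[OF Z t'(1) tf(1)] tf by auto
      with t' show "u = (cut \<sigma> x t - k, f)" by simp
    qed
  qed
  then show ?thesis unfolding tiling_def using block by (auto simp: cut_tiles_def)
qed

section \<open>Recovering a centered representation from its tiling\<close>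

definition letter_tiles :: "('a \<Rightarrow> 'b list) \<Rightarrow> (int \<Rightarrow> 'a) \<Rightarrow> int \<Rightarrow> (int \<times> 'a) set" where
  "letter_tiles \<sigma> x k = range (\<lambda>i. (cut \<sigma> x i - k, x i))"

text \<open>On the right-hand side \<open>x\<close>, \<open>k\<close> and \<open>Z\<close> enter
  only through \<open>cut_tiles\<close>. Hence equal tilings by images of words give equal tilings
  by images of letters.\<close>

lemma letter_tiles_from_blocks:
  assumes Z: "tiling (\<lambda>w. w) F x Z"
  shows "letter_tiles \<sigma> x k =
    {(s + int (length (word_ext \<sigma> (take j f))), f ! j) | s f j.
      (s, f) \<in> cut_tiles \<sigma> x k Z \<and> j < length f}"
proof -
  have eq: "(cut \<sigma> x t - k + int (length (word_ext \<sigma> (take j f))), f ! j) =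
      (cut \<sigma> x (t + int j) - k, x (t + int j))" if "(t, f) \<in> Z" "j < length f" for t f j
    using cut_word[of \<sigma> x t j] tile_word[OF Z that(1), of j] tilingD(3)[OF Z that] that by simp
  show ?thesis
  proof (intro equalityI subsetI)
    fix u assume "u \<in> letter_tiles \<sigma> x k"
    then obtain i where u: "u = (cut \<sigma> x i - k, x i)" by (auto simp: letter_tiles_def)
    obtain t f where tf: "(t, f) \<in> Z" "t \<le> i" "i < t + int (length f)"
      using tiling_cover[OF Z] by blast
    define j where "j = nat (i - t)"
    have "i = t + int j" "j < length f" using tf by (auto simp: j_def)
    then have "u = (cut \<sigma> x t - k + int (length (word_ext \<sigma> (take j f))), f ! j)"
      using u eq[OF tf(1)] by simp
    moreover have "(cut \<sigma> x t - k, f) \<in> cut_tiles \<sigma> x k Z" using tf(1) by (auto simp: cut_tiles_def)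
    ultimately show "u \<in> {(s + int (length (word_ext \<sigma> (take j f))), f ! j) | s f j.
      (s, f) \<in> cut_tiles \<sigma> x k Z \<and> j < length f}" using \<open>j < length f\<close> by blast
  next
    fix u assume "u \<in> {(s + int (length (word_ext \<sigma> (take j f))), f ! j) | s f j.
      (s, f) \<in> cut_tiles \<sigma> x k Z \<and> j < length f}"
    then obtain t f j where "(t, f) \<in> Z" "j < length f"
      "u = (cut \<sigma> x t - k + int (length (word_ext \<sigma> (take j f))), f ! j)"
      by (auto simp: cut_tiles_def)
    then show "u \<in> letter_tiles \<sigma> x k" using eq by (auto simp: letter_tiles_def)
  qed
qed

lemma letter_tiles_unique:
  assumes "(t, a) \<in> letter_tiles \<sigma> x k" "(t', a') \<in> letter_tiles \<sigma> x k"
    and "t \<le> s" "s < t + int (length (\<sigma> a))" "t' \<le> s" "s < t' + int (length (\<sigma> a'))"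
  shows "t = t' \<and> a = a'"
proof -
  obtain i i' where i: "t = cut \<sigma> x i - k" "a = x i" "t' = cut \<sigma> x i' - k" "a' = x i'"
    using assms(1,2) by (auto simp: letter_tiles_def)
  have "i = i'"
    using assms(3-6) i cut_step[of \<sigma> x i] cut_step[of \<sigma> x i'] cut_mono[of "i + 1" i' \<sigma> x]
      cut_mono[of "i' + 1" i \<sigma> x] by (cases i i' rule: linorder_cases) auto
  with i show ?thesis by simp
qed

text \<open>Centering says that the block of \<open>x 0\<close> is the one covering position 0, so
  the tiling singles it out; its neighbours are then read off in both directions.\<close>

lemma centered_letter_tiles_inj:
  assumes ne: "\<And>i. \<sigma> (x i) \<noteq> []" "\<And>i. \<sigma> (x' i) \<noteq> []"
    and k: "0 \<le> k" "k < int (length (\<sigma> (x 0)))" "0 \<le> k'" "k' < int (length (\<sigma> (x' 0)))"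
    and eq: "letter_tiles \<sigma> x k = letter_tiles \<sigma> x' k'"
  shows "k = k'" "x = x'"
proof -
  have tx: "(cut \<sigma> x i - k, x i) \<in> letter_tiles \<sigma> x k" for i by (auto simp: letter_tiles_def)
  have tx': "(cut \<sigma> x' i - k', x' i) \<in> letter_tiles \<sigma> x k" for i
    unfolding eq by (auto simp: letter_tiles_def)
  note uniq = letter_tiles_unique[OF tx tx']
  have 0: "- k = - k' \<and> x 0 = x' 0" using uniq[of 0 0 0] k by (simp add: cut_0)
  then show kk: "k = k'" by simp
  have "cut \<sigma> x i = cut \<sigma> x' i \<and> x i = x' i" for i
  proof (induction i rule: int_induct[where k = 0])
    case base
    then show ?case using 0 by (simp add: cut_0)
  next
    case (step1 i)
    then have "cut \<sigma> x (i + 1) = cut \<sigma> x' (i + 1)" by (simp add: cut_step)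
    then show ?case
      using uniq[of "i + 1" "cut \<sigma> x (i + 1) - k" "i + 1"] ne kk by simp
  next
    case (step2 i)
    have "cut \<sigma> x i = cut \<sigma> x (i - 1) + int (length (\<sigma> (x (i - 1))))"
      "cut \<sigma> x' i = cut \<sigma> x' (i - 1) + int (length (\<sigma> (x' (i - 1))))"
      using cut_step[of \<sigma> x "i - 1"] cut_step[of \<sigma> x' "i - 1"] by simp_all
    moreover have "length (\<sigma> (x (i - 1))) > 0" "length (\<sigma> (x' (i - 1))) > 0" using ne by auto
    \<comment> \<open>Position \<open>cut \<sigma> x i - k - 1\<close> is the last one of both
      blocks of index \<open>i - 1\<close>.\<close>
    ultimately show ?case
      using uniq[of "i - 1" "cut \<sigma> x i - k - 1" "i - 1"] kk step2 by linarith
  qed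
  then show "x = x'" by blast
qed

section \<open>Levels of a directive sequence\<close>

lemma comp_range_same [simp]: "comp_range \<sigma> n n w = w"
  by (simp add: comp_range_def)

lemma comp_range_first:
  assumes "n < N"
  shows "comp_range \<sigma> n N w = word_ext (\<sigma> n) (comp_range \<sigma> (Suc n) N w)"
  using assms by (simp add: comp_range_def upt_conv_Cons)

lemma comp_range_trans:
  assumes "n \<le> N" "N \<le> M"
  shows "comp_range \<sigma> n M w = comp_range \<sigma> n N (comp_range \<sigma> N M w)"
  using assms(1)
proof (induction n rule: inc_induct)
  case (step n)
  then show ?case using assms(2) by (simp add: comp_range_first)
qed simp

lemma word_ext_concat: "word_ext \<sigma> (concat ws) = concat (map (word_ext \<sigma>) ws)"
  by (induction ws) (simp_all add: word_ext_def)

lemma comp_range_concat: "comp_range \<sigma> n N w = concat (map (\<lambda>a. comp_range \<sigma> n N [a]) w)"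
proof -
  have "foldr (\<lambda>m f. word_ext (\<sigma> m) \<circ> f) ms id w =
      concat (map (\<lambda>a. foldr (\<lambda>m f. word_ext (\<sigma> m) \<circ> f) ms id [a]) w)" for ms
    by (induction ms) (simp_all add: word_ext_concat o_def)
  then show ?thesis by (simp add: comp_range_def)
qed

lemma word_ext_lists:
  assumes "is_morphism A B \<sigma>" "w \<in> lists A"
  shows "word_ext \<sigma> w \<in> lists B"
  using assms unfolding is_morphism_def word_ext_def by fastforce

lemma concat_in_concat_lists:
  assumes "\<And>w. w \<in> set ws \<Longrightarrow> w \<in> concat ` lists F"
  shows "concat ws \<in> concat ` lists F"
  using assms
proof (induction ws)
  case Nil
  then show ?case by (auto intro!: image_eqI[of _ _ "[]"])
next
  case (Cons w ws)
  have "concat ws \<in> concat ` lists F" using Cons by simp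
  then obtain vs where "vs \<in> lists F" "concat ws = concat vs" by blast
  moreover obtain us where "us \<in> lists F" "w = concat us" using Cons.prems[of w] by auto
  ultimately show ?case by (intro image_eqI[of _ _ "us @ vs"]) auto
qed

lemma concat_lists_restrict:
  assumes "w \<in> concat ` lists F" "w \<in> lists B"
  shows "w \<in> concat ` lists {f \<in> F. f \<noteq> [] \<and> f \<in> lists B}"
proof -
  obtain ws where ws: "ws \<in> lists F" "w = concat ws" using assms(1) by blast
  have eq: "w = concat (filter (\<lambda>f. f \<noteq> []) ws)" unfolding ws(2) by (induction ws) auto
  have "filter (\<lambda>f. f \<noteq> []) ws \<in> lists {f \<in> F. f \<noteq> [] \<and> f \<in> lists B}"
    using ws assms(2) by auto
  then show ?thesis using eq by (rule image_eqI[rotated])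
qed

locale directive_sequence =
  fixes A :: "nat \<Rightarrow> 'a set" and \<sigma> :: "nat \<Rightarrow> 'a \<Rightarrow> 'a list"
  assumes finite_A: "\<And>n. finite (A n)"
    and morphism: "\<And>n. is_morphism (A (Suc n)) (A n) (\<sigma> n)"
begin

lemma comp_range_lists:
  assumes "n \<le> N" "w \<in> lists (A N)"
  shows "comp_range \<sigma> n N w \<in> lists (A n)"
  using assms(1)
proof (induction n rule: inc_induct)
  case (step n)
  then show ?case using word_ext_lists[OF morphism] by (simp add: comp_range_first)
qed (use assms(2) in simp)

section \<open>Generating sets and the rank of a level\<close>

definition generates :: "nat \<Rightarrow> nat \<Rightarrow> 'a list set \<Rightarrow> bool" where
  "generates n N F \<longleftrightarrow> (\<forall>a\<in>A N. comp_range \<sigma> n N [a] \<in> concat ` lists F)"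

lemma generates_word:
  assumes "generates n N F" "w \<in> lists (A N)"
  shows "comp_range \<sigma> n N w \<in> concat ` lists F"
  unfolding comp_range_concat[of \<sigma> n N w]
  by (rule concat_in_concat_lists) (use assms in \<open>auto simp: generates_def\<close>)

text \<open>Generating sets are pushed down one level. This gives the monotonicity of
  \<open>rank\<close> and, for equal ranks, elementarity.\<close>

lemma generates_trans:
  assumes "generates (Suc n) N F" "n < N" "\<And>f. f \<in> F \<Longrightarrow> word_ext (\<sigma> n) f \<in> concat ` lists G"
  shows "generates n N G"
  unfolding generates_def
proof
  fix a assume "a \<in> A N"
  then obtain fs where fs: "fs \<in> lists F" "comp_range \<sigma> (Suc n) N [a] = concat fs"
    using assms(1) unfolding generates_def by blast
  have "concat (map (word_ext (\<sigma> n)) fs) \<in> concat ` lists G"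
    by (rule concat_in_concat_lists) (use fs(1) assms(3) in auto)
  then show "comp_range \<sigma> n N [a] \<in> concat ` lists G"
    by (simp add: comp_range_first[OF assms(2)] fs(2) word_ext_concat)
qed

definition rank :: "nat \<Rightarrow> nat" where
  "rank n = (LEAST k. \<exists>N>n. \<exists>F. finite F \<and> card F = k \<and> generates n N F)"

lemma generates_images: "generates n M ((\<lambda>a. comp_range \<sigma> n M [a]) ` A M)"
  unfolding generates_def by (auto intro!: image_eqI[of _ concat "[_]"])

lemma rank_le:
  assumes "n < N" "finite F" "generates n N F"
  shows "rank n \<le> card F"
  unfolding rank_def by (rule Least_le) (intro exI[of _ N] exI[of _ F] conjI assms refl)

lemma rank_attained:
  obtains N F where "n < N" "finite F" "card F = rank n" "generates n N F"
proof -
  let ?P = "\<lambda>k. \<exists>N>n. \<exists>F. finite F \<and> card F = k \<and> generates n N F"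
  have "?P (card ((\<lambda>a. comp_range \<sigma> n (Suc n) [a]) ` A (Suc n)))"
    using generates_images[of n "Suc n"] finite_A
    by (intro exI[of _ "Suc n"] conjI exI[of _ "(\<lambda>a. comp_range \<sigma> n (Suc n) [a]) ` A (Suc n)"]) auto
  then have "?P (rank n)" unfolding rank_def by (rule LeastI)
  then show ?thesis using that by blast
qed

text \<open>The images of the letters of any later alphabet generate, so a single small alphabet
  beyond \<open>n\<close> bounds \<open>rank n\<close>.\<close>

lemma rank_le_card:
  assumes "n < M"
  shows "rank n \<le> card (A M)"
proof -
  have "rank n \<le> card ((\<lambda>a. comp_range \<sigma> n M [a]) ` A M)"
    using assms finite_A generates_images by (intro rank_le) auto
  also have "\<dots> \<le> card (A M)" by (rule card_image_le[OF finite_A])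
  finally show ?thesis .
qed

lemma rank_Suc: "rank n \<le> rank (Suc n)"
proof -
  obtain N F where F: "Suc n < N" "finite F" "card F = rank (Suc n)" "generates (Suc n) N F"
    using rank_attained .
  have "generates n N (word_ext (\<sigma> n) ` F)"
    using F by (intro generates_trans[OF F(4)]) (auto intro!: image_eqI[of _ concat "[_]"])
  then have "rank n \<le> card (word_ext (\<sigma> n) ` F)" using F by (intro rank_le) auto
  also have "\<dots> \<le> rank (Suc n)" using card_image_le[OF F(2)] F(3) by metis
  finally show ?thesis .
qed

lemma rank_eventually_const:
  assumes "liminf (\<lambda>n. ecard (A n)) < \<infinity>"
  shows "\<exists>n0. \<forall>n\<ge>n0. rank (Suc n) = rank n"
proof -
  obtain K where K: "liminf (\<lambda>n. ecard (A n)) = enat K" using assms by auto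
  have "rank n \<le> K" for n
  proof -
    \<comment> \<open>The liminf is the supremum of the infima over tails; an infimum below
      \<open>Suc K\<close> is witnessed by some level \<open>m\<close> of the tail.\<close>
    have "(INF m\<in>{Suc n..}. ecard (A m)) \<le> enat K"
      using K unfolding liminf_SUP_INF by (metis SUP_upper UNIV_I)
    also have "\<dots> < enat (Suc K)" by simp
    finally obtain m where m: "m \<ge> Suc n" "ecard (A m) < enat (Suc K)"
      unfolding INF_less_iff by auto
    then have "card (A m) \<le> K" using finite_A by (simp add: ecard_def)
    with m show ?thesis using rank_le_card[of n m] by simp
  qed
  then have fin: "finite (range rank)" by (intro finite_subset[of "range rank" "{..K}"]) auto
  have "Max (range rank) \<in> range rank" using fin by (intro Max_in) auto
  then obtain n0 where n0: "rank n0 = Max (range rank)" by auto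
  have const: "rank n = rank n0" if "n \<ge> n0" for n
    using lift_Suc_mono_le[of rank, OF rank_Suc that] n0 fin by (simp add: antisym)
  have "rank (Suc n) = rank n" if "n \<ge> n0" for n
    using const[OF that] const[of "Suc n"] that by simp
  then show ?thesis by blast
qed

text \<open>Only finitely many words are images of letters from levels below \<open>N\<close>. A
  subword of \<open>x\<close> longer than all of them comes from a level \<open>M \<ge> N\<close>,
  and such images factor over \<open>F\<close>; compactness does the rest.\<close>

lemma level_shift_tiling:
  assumes x: "x \<in> level_shift A \<sigma> m" and N: "m < N"
    and F: "finite F" "[] \<notin> F" "generates m N F"
  obtains Z where "tiling (\<lambda>w. w) F x Z"
proof -
  define B where "B = (\<Union>M\<in>{m..<N}. (\<lambda>a. length (comp_range \<sigma> m M [a])) ` A M)"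
  have "finite B" unfolding B_def using finite_A by auto
  have "\<exists>fs\<in>lists F. sublist (map (\<lambda>j. x (- int J + int j)) [0..<2 * J]) (concat fs)" for J
  proof -
    \<comment> \<open>The window is enlarged until no image from a level below \<open>N\<close> can
      contain it. \<open>insert 0\<close> keeps \<open>Max\<close> defined if \<open>B\<close> is
      empty.\<close>
    define J' where "J' = max J (Suc (Max (insert 0 B)))"
    define w where "w = map (\<lambda>j. x (- int J' + int j)) [0..<2 * J']"
    have "w \<in> lang x" unfolding w_def lang_def by blast
    then have "w \<in> level_lang A \<sigma> m" using x unfolding level_shift_def by blast
    then obtain M a where M: "M > m" "a \<in> A M" "sublist w (comp_range \<sigma> m M [a])"
      unfolding level_lang_def by blast
    have "N \<le> M"
    proof (rule ccontr)
      assume "\<not> N \<le> M"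
      then have "length (comp_range \<sigma> m M [a]) \<in> B" using M unfolding B_def by auto
      then have "length (comp_range \<sigma> m M [a]) \<le> Max (insert 0 B)" using \<open>finite B\<close> by auto
      moreover have "length w \<le> length (comp_range \<sigma> m M [a])"
        using M(3) by (rule sublist_length_le)
      moreover have "Suc (Max (insert 0 B)) \<le> J'" unfolding J'_def by simp
      ultimately show False unfolding w_def by simp
    qed
    then have "comp_range \<sigma> m M [a] = comp_range \<sigma> m N (comp_range \<sigma> N M [a])"
      using N by (intro comp_range_trans) auto
    moreover have "comp_range \<sigma> N M [a] \<in> lists (A N)"
      using \<open>N \<le> M\<close> M(2) by (intro comp_range_lists) auto
    ultimately have "comp_range \<sigma> m M [a] \<in> concat ` lists F"
      using generates_word[OF F(3)] by simp
    then obtain fs where fs: "fs \<in> lists F" "sublist w (concat fs)"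
      using M(3) by (metis imageE)
    have J: "J \<le> J'" by (simp add: J'_def)
    have "w = map (\<lambda>j. x (- int J' + int j)) [0..<J' - J] @
        map (\<lambda>j. x (- int J + int j)) [0..<2 * J] @ map (\<lambda>j. x (int J + int j)) [0..<J' - J]"
      unfolding w_def using J
      by (intro nth_equalityI) (auto simp: nth_append of_nat_diff intro!: arg_cong[of _ _ x])
    then have "sublist (map (\<lambda>j. x (- int J + int j)) [0..<2 * J]) w"
      unfolding sublist_def by blast
    then show ?thesis using fs sublist_order.order_trans by blast
  qed
  then show ?thesis using tiling_by_compactness[OF F(1,2), of x] that by blast
qed

text \<open>Both representations give tilings of \<open>y\<close> by images of words from a smallest
  generating set \<open>F\<close>. These coincide by elementarity and aperiodicity, and centering
  then recovers \<open>k\<close> and \<open>x\<close>.\<close>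

lemma centered_representation_unique:
  assumes r: "rank (Suc n) = rank n" and y: "aperiodic y"
    and rep: "centered_representation (\<sigma> n) (level_shift A \<sigma> (Suc n)) y (k, x)"
      "centered_representation (\<sigma> n) (level_shift A \<sigma> (Suc n)) y (k', x')"
  shows "k = k' \<and> x = x'"
proof -
  obtain N F0 where F0: "Suc n < N" "finite F0" "card F0 = rank (Suc n)" "generates (Suc n) N F0"
    using rank_attained .
  define F where "F = {f \<in> F0. f \<noteq> [] \<and> f \<in> lists (A (Suc n))}"
  have F: "finite F" "[] \<notin> F" using F0(2) by (auto simp: F_def)
  have cF: "card F \<le> rank n" using card_mono[OF F0(2), of F] F0(3) r by (auto simp: F_def)
  have gF: "generates (Suc n) N F"
    unfolding generates_def F_def
  proof (intro ballI concat_lists_restrict)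
    fix a assume a: "a \<in> A N"
    show "comp_range \<sigma> (Suc n) N [a] \<in> concat ` lists F0"
      using F0(4) a unfolding generates_def by blast
    show "comp_range \<sigma> (Suc n) N [a] \<in> lists (A (Suc n))"
      using F0(1) a by (intro comp_range_lists) auto
  qed
  \<comment> \<open>Words generating the images of \<open>F\<close> generate level \<open>n\<close>,
    so there are at least \<open>rank n\<close> of them; equality of the ranks gives
    \<open>card F \<le> rank n\<close>.\<close>
  have el: "elementary (word_ext (\<sigma> n)) F"
    unfolding elementary_def
  proof (intro allI impI)
    fix G assume G: "finite G" "\<forall>c\<in>F. word_ext (\<sigma> n) c \<in> concat ` lists G"
    have "generates n N G" using generates_trans[OF gF] G(2) F0(1) by auto
    then have "rank n \<le> card G" using G(1) F0(1) by (intro rank_le) auto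
    with cF show "card F \<le> card G" by simp
  qed
  have X: "x \<in> level_shift A \<sigma> (Suc n)" "x' \<in> level_shift A \<sigma> (Suc n)"
    and Y: "y = shift k (seq_ext (\<sigma> n) x)" "y = shift k' (seq_ext (\<sigma> n) x')"
    and K: "0 \<le> k" "k < int (length (\<sigma> n (x 0)))" "0 \<le> k'" "k' < int (length (\<sigma> n (x' 0)))"
    using rep by (auto simp: centered_representation_def representation_def)
  have ne: "\<sigma> n (x i) \<noteq> []" "\<sigma> n (x' i) \<noteq> []" for i
    using X morphism[of n] by (auto simp: level_shift_def full_shift_def is_morphism_def)
  obtain Z where Z: "tiling (\<lambda>w. w) F x Z" using level_shift_tiling[OF X(1) F0(1) F gF] .
  obtain Z' where Z': "tiling (\<lambda>w. w) F x' Z'" using level_shift_tiling[OF X(2) F0(1) F gF] .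
  have "tiling (word_ext (\<sigma> n)) F y (cut_tiles (\<sigma> n) x k Z)"
    unfolding Y(1) by (rule tiling_word_ext[of "\<sigma> n" x, OF ne(1) Z])
  moreover have "tiling (word_ext (\<sigma> n)) F y (cut_tiles (\<sigma> n) x' k' Z')"
    unfolding Y(2) by (rule tiling_word_ext[of "\<sigma> n" x', OF ne(2) Z'])
  ultimately have "cut_tiles (\<sigma> n) x k Z = cut_tiles (\<sigma> n) x' k' Z'"
    using elementary_tiling_unique[OF F(1) el _ _ y] by blast
  then have "letter_tiles (\<sigma> n) x k = letter_tiles (\<sigma> n) x' k'"
    by (simp add: letter_tiles_from_blocks[OF Z] letter_tiles_from_blocks[OF Z'])
  then show ?thesis using centered_letter_tiles_inj[of "\<sigma> n" x x' k k', OF ne K] by simp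
qed

end

theorem theorem5p1:
  fixes A :: "nat \<Rightarrow> 'a set" and \<sigma> :: "nat \<Rightarrow> 'a \<Rightarrow> 'a list"
  assumes "\<And>n. finite (A n)"
    and "\<And>n. is_morphism (A (Suc n)) (A n) (\<sigma> n)"
    and "liminf (\<lambda>n. ecard (A n)) < \<infinity>"
    and "(SUP n. ecard {lang x | x. x \<in> level_shift A \<sigma> n}) < \<infinity>"
  shows "\<exists>n0. \<forall>n\<ge>n0. \<forall>y \<in> full_shift (A n). aperiodic y \<longrightarrow>
           (\<exists>\<^sub>\<le>\<^sub>1 p. centered_representation (\<sigma> n) (level_shift A \<sigma> (Suc n)) y p)"
proof -
  interpret directive_sequence A \<sigma> using assms(1,2) by unfold_locales
  obtain n0 where n0: "\<forall>n\<ge>n0. rank (Suc n) = rank n"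
    using rank_eventually_const[OF assms(3)] by blast
  have "\<exists>\<^sub>\<le>\<^sub>1 p. centered_representation (\<sigma> n) (level_shift A \<sigma> (Suc n)) y p"
    if "n \<ge> n0" "aperiodic y" for n y
  proof (rule Uniq_I)
    fix p q
    assume "centered_representation (\<sigma> n) (level_shift A \<sigma> (Suc n)) y p"
      "centered_representation (\<sigma> n) (level_shift A \<sigma> (Suc n)) y q"
    then show "p = q"
      using centered_representation_unique[OF n0[rule_format, OF that(1)] that(2),
          of "fst p" "snd p" "fst q" "snd q"]
      by (simp add: prod_eq_iff)
  qed
  then show ?thesis by blast
qed

end
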